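(* Let $A=(a_{ij})\in\Bbbk^{s\times t}$ be a free-injective matrix with cogenerator degrees $\alpha_1,\dots,\alpha_s\in\mathbb N^n$ and generator degrees $\beta_1,\dots,\beta_t\in\mathbb N^n$, and suppose $A$ is in Gröbner form. Then the algorithm FreePresentation terminates on input $A$ and computes a free presentation of the module $\operatorname{im}A$; that is, if $P\in R^{t\times r}$ is the output matrix, then $$R^r\xrightarrow{\ P\ }R^t\xrightarrow{\ \mathbf e_j\mapsto\varphi_A(\mathbf e_j)\ }\operatorname{im}A\longrightarrow0$$ is exact.
   Context: $\Bbbk$ is a field, $R=\Bbbk[X_1,\dots,X_n]$ with the standard $\mathbb Z^n$-grading, $(\Sigma^\beta M)_\alpha=M_{\alpha-\beta}$, and $E(\Bbbk)=\Bbbk[X_1^{-1},\dots,X_n^{-1}]$ is the graded injective hull of $\Bbbk$ (a monomial multiple is $0$ as soon as it has a positive exponent). A free-injective matrix is a matrix $A=(a_{ij})\in\Bbbk^{s\times t}$ with cogenerator degrees $\alpha_1,\dots,\alpha_s$ and generator degrees $\beta_1,\dots,\beta_t$ such that $a_{ij}=0$ unless $\beta_j\le\alpha_i$ componentwise. It represents the graded homomorphism $\varphi_A\colon\bigoplus_{j=1}^t\Sigma^{\beta_j}R\to E:=\bigoplus_{i=1}^s\Sigma^{\alpha_i}E(\Bbbk)$ sending the $j$-th basis element $\mathbf e_j$ to the element of degree $\beta_j$ whose $i$-th component is $a_{ij}X^{\beta_j-\alpha_i}$; $\operatorname{im}A:=\operatorname{im}\varphi_A$. Fix a monomial order on $R^s$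 (a well-order on the module monomials $X^\gamma\mathbf e_i$ compatible with multiplication by monomials), with $\mathrm{lm},\mathrm{lc},\mathrm{lt}$ the leading monomial, coefficient, term, and $\mathrm{lm}(W)$ the $\Bbbk$-span of the leading monomials of non-zero elements of a submodule $W$. Let $G_E=\{X_k^{\alpha_{ik}+1}\mathbf e_i\mid 1\le i\le s,1\le k\le n\}\subseteq R^s$ with $\alpha_i=(\alpha_{i1},\dots,\alpha_{in})$, $U_E=\langle G_E\rangle$, $\mathbf h_j=X^{\beta_j}\sum_{i=1}^s a_{ij}\mathbf e_i\in R^s$, $H_A=\{\mathbf h_1,\dots,\mathbf h_t\}$, $V_A=\langle H_A\rangle+U_E$. One has $E_{\mathbb N^n}\cong R^s/U_E$, under which $\operatorname{im}A$ corresponds to $V_A/U_E$ and $\varphi_A(\mathbf e_j)$ to $\mathbf h_j+U_E$. $A$ is in Gröbner form if $H_A$ is a Gröbner basis of $V_A$ relative to $U_E$: $H_A\subseteq V_A\setminus U_E$, its elements are supported on module monomials not in $\mathrm{lm}(U_E)$, and $\langle\mathrm{lm}(H_A)\rangle+\mathrm{lm}(U_E)=\mathrm{lm}(V_A)$. Relative division of $\mathbf f\in R^s$ by $(\mathbf h_1,\dots,\mathbf h_t)$ modulo $G_E$: start with $\tilde{\mathbf f}=\mathbf f$, $\mathbf p=0$, $q_1=\dots=q_t=0$. While $\tilde{\mathbf f}\ne0$: if $\mathrm{lm}(\tilde{\mathbf f})$ is divisible by some $\mathbf g\in G_E$, replace $\tilde{\mathbf f}$ by $\tilde{\mathbf f}-\frac{\mathrm{lt}(\tilde{\mathbf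 f})}{\mathrm{lt}(\mathbf g)}\mathbf g$; else if it is divisible by some $\mathrm{lm}(\mathbf h_j)$, add $\frac{\mathrm{lt}(\tilde{\mathbf f})}{\mathrm{lt}(\mathbf h_j)}$ to $q_j$ and subtract $\frac{\mathrm{lt}(\tilde{\mathbf f})}{\mathrm{lt}(\mathbf h_j)}\mathbf h_j$ from $\tilde{\mathbf f}$; else move $\mathrm{lt}(\tilde{\mathbf f})$ from $\tilde{\mathbf f}$ to $\mathbf p$. Output $(\mathbf p,q_1,\dots,q_t)$. For $\mathbf f,\mathbf g$ with leading monomials in the same component, $\mathbf S(\mathbf f,\mathbf g)=\frac{\mathbf m}{\mathrm{lt}(\mathbf f)}\mathbf f-\frac{\mathbf m}{\mathrm{lt}(\mathbf g)}\mathbf g$, $\mathbf m=\mathrm{lcm}(\mathrm{lm}(\mathbf f),\mathrm{lm}(\mathbf g))$. Algorithm FreePresentation: the output matrix has as columns all non-zero vectors $\sigma\in R^t$ of the following two kinds, where $\vee$ is the componentwise maximum and $\varepsilon_k$ the $k$-th unit vector of $\mathbb Z^n$. (a) For each $1\le j_1<j_2\le t$ such that $\mathrm{lm}(\mathbf h_{j_1}),\mathrm{lm}(\mathbf h_{j_2})$ involve the same basis vector: divide $\mathbf S(\mathbf h_{j_1},\mathbf h_{j_2})$ to get $(\mathbf p,a_1,\dots,a_t)$ and put $\sigma=\mathrm{lc}(\mathbf h_{j_1})^{-1}X^{\beta_{j_1}\vee\beta_{j_2}-\beta_{j_1}}\mathbf e_{j_1}-\mathrm{lc}(\mathbf h_{j_2})^{-1}X^{\beta_{j_1}\vee\beta_{j_2}-\beta_{j_2}}\mathbf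 e_{j_2}-\sum_l a_l\mathbf e_l$. (b) For each $1\le j\le t$, with $\mathbf e_i$ the basis vector of $\mathrm{lm}(\mathbf h_j)$, and each $1\le k\le n$: divide $\mathbf S(\mathbf h_j,X_k^{\alpha_{ik}+1}\mathbf e_i)$ to get $(\mathbf p,a_1,\dots,a_t)$ and put $\sigma=\mathrm{lc}(\mathbf h_j)^{-1}X^{\beta_j\vee(\alpha_{ik}+1)\varepsilon_k-\beta_j}\mathbf e_j-\sum_l a_l\mathbf e_l$. *)

theory Defs
  imports Complex_Main "HOL-Library.Poly_Mapping" "HOL-Library.Function_Algebras" "HOL-Library.Set_Algebras"
begin

(* The variables are indexed by a finite type 'n. Exponents are functions, so that +, -, \<le> and
   sup act componentwise on them. The index sets 1..s, 1..t, 1..r become {..<s}, {..<t}, {..<r};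
   the size r of the output is only known after the computation, so these are numbers and not
   types, and R^m is a subset of one type of finitely supported vectors. *)

type_synonym ('n, 'k) mpoly = "('n \<Rightarrow> nat) \<Rightarrow>\<^sub>0 'k"
type_synonym ('n, 'k) pvec = "nat \<Rightarrow>\<^sub>0 ('n, 'k) mpoly"
type_synonym 'n mmon = "nat \<times> ('n \<Rightarrow> nat)" \<comment> \<open>\<open>(i, \<gamma>)\<close> stands for \<open>X^\<gamma> e_i\<close>\<close>

definition free_module :: "nat \<Rightarrow> ('n, 'k::field) pvec set" where
  "free_module m = {x. Poly_Mapping.keys x \<subseteq> {..<m}}"

definition vscale :: "('n, 'k::field) mpoly \<Rightarrow> ('n, 'k) pvec \<Rightarrow> ('n, 'k) pvec" where
  "vscale p x = Poly_Mapping.map ((*) p) x"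

definition kscale :: "'k::field \<Rightarrow> ('n, 'k) pvec \<Rightarrow> ('n, 'k) pvec" where
  "kscale c = vscale (Poly_Mapping.single 0 c)"

lemma lookup_vscale [simp]:
  "Poly_Mapping.lookup (vscale p x) i = p * Poly_Mapping.lookup x i"
  by (simp add: vscale_def Poly_Mapping.map.rep_eq when_def)

interpretation R_mod: module "vscale :: ('n, 'k::field) mpoly \<Rightarrow> _"
  by unfold_locales (auto intro!: poly_mapping_eqI simp: lookup_add algebra_simps)

interpretation k_mod: vector_space "kscale :: 'k::field \<Rightarrow> ('n, 'k) pvec \<Rightarrow> _"
  by unfold_locales
    (simp_all add: kscale_def R_mod.scale_right_distrib single_add R_mod.scale_left_distrib
      mult_single)

definition mvec :: "'n mmon \<Rightarrow> 'k \<Rightarrow> ('n, 'k::field) pvec" where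
  "mvec m c = Poly_Mapping.single (fst m) (Poly_Mapping.single (snd m) c)"

definition vcoeff :: "('n, 'k::field) pvec \<Rightarrow> 'n mmon \<Rightarrow> 'k" where
  "vcoeff f m = Poly_Mapping.lookup (Poly_Mapping.lookup f (fst m)) (snd m)"

definition msupp :: "('n, 'k::field) pvec \<Rightarrow> 'n mmon set" where
  "msupp f = {m. vcoeff f m \<noteq> 0}"

definition mmon_dvd :: "'n mmon \<Rightarrow> 'n mmon \<Rightarrow> bool" where
  "mmon_dvd m m' \<longleftrightarrow> fst m = fst m' \<and> snd m \<le> snd m'"

definition monomial_order :: "nat \<Rightarrow> 'n mmon rel \<Rightarrow> bool" where
  "monomial_order s ord \<longleftrightarrow>
     well_order_on {m. fst m < s} ord \<and>
     (\<forall>i \<gamma> j \<delta> \<mu>. ((i, \<gamma>), (j, \<delta>)) \<in> ord \<longrightarrow> ((i, \<mu> + \<gamma>), (j, \<mu> + \<delta>)) \<in> ord)"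

(* The next four notions are meaningful only for f \<noteq> 0. *)

definition lm :: "'n mmon rel \<Rightarrow> ('n, 'k::field) pvec \<Rightarrow> 'n mmon" where
  "lm ord f = (THE m. m \<in> msupp f \<and> (\<forall>m'\<in>msupp f. (m', m) \<in> ord))"

definition lc :: "'n mmon rel \<Rightarrow> ('n, 'k::field) pvec \<Rightarrow> 'k" where
  "lc ord f = vcoeff f (lm ord f)"

definition lt :: "'n mmon rel \<Rightarrow> ('n, 'k::field) pvec \<Rightarrow> ('n, 'k) pvec" where
  "lt ord f = mvec (lm ord f) (lc ord f)"

(* lt f / lt g, for lm g dividing lm f *)
definition lt_quot ::
  "'n mmon rel \<Rightarrow> ('n, 'k::field) pvec \<Rightarrow> ('n, 'k) pvec \<Rightarrow> ('n, 'k) mpoly" where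
  "lt_quot ord f g =
     Poly_Mapping.single (snd (lm ord f) - snd (lm ord g)) (lc ord f / lc ord g)"

definition lm_space :: "'n mmon rel \<Rightarrow> ('n, 'k::field) pvec set \<Rightarrow> ('n, 'k) pvec set" where
  "lm_space ord W = k_mod.span {mvec (lm ord w) 1 | w. w \<in> W \<and> w \<noteq> 0}"

(* Sums of sets of vectors are elementwise. *)
definition rel_groebner_basis ::
  "'n mmon rel \<Rightarrow> ('n, 'k::field) pvec set \<Rightarrow> ('n, 'k) pvec set \<Rightarrow> ('n, 'k) pvec set \<Rightarrow> bool"
where
  "rel_groebner_basis ord U V H \<longleftrightarrow>
     H \<subseteq> V - U \<and>
     (\<forall>h\<in>H. \<forall>m\<in>msupp h. mvec m 1 \<notin> lm_space ord U) \<and>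
     R_mod.span {mvec (lm ord h) 1 | h. h \<in> H} + lm_space ord U = lm_space ord V"

definition S_vec ::
  "'n mmon rel \<Rightarrow> ('n, 'k::field) pvec \<Rightarrow> ('n, 'k) pvec \<Rightarrow> ('n, 'k) pvec" where
  "S_vec ord f g =
     (let \<gamma> = snd (lm ord f); \<delta> = snd (lm ord g) in
        vscale (Poly_Mapping.single (sup \<gamma> \<delta> - \<gamma>) (inverse (lc ord f))) f -
        vscale (Poly_Mapping.single (sup \<gamma> \<delta> - \<delta>) (inverse (lc ord g))) g)"

(* An entry a i j outside i < s, j < t is irrelevant. *)
definition free_injective ::
  "nat \<Rightarrow> nat \<Rightarrow> (nat \<Rightarrow> nat \<Rightarrow> 'k::field) \<Rightarrow> (nat \<Rightarrow> 'n \<Rightarrow> nat) \<Rightarrow> (nat \<Rightarrow> 'n \<Rightarrow> nat) \<Rightarrow> bool" where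
  "free_injective s t a \<alpha> \<beta> \<longleftrightarrow> (\<forall>i<s. \<forall>j<t. \<not> \<beta> j \<le> \<alpha> i \<longrightarrow> a i j = 0)"

(* E(k) = k[X_1^-1, ..., X_n^-1]. The shift by \<alpha>_i changes the grading of E(k) only, so the
   module E is the direct sum of s copies of E(k). *)

definition inv_poly :: "(('n \<Rightarrow> int) \<Rightarrow>\<^sub>0 'k::field) set" where
  "inv_poly = {e. \<forall>\<delta>\<in>Poly_Mapping.keys e. \<delta> \<le> 0}"

definition inv_act ::
  "('n, 'k::field) mpoly \<Rightarrow> (('n \<Rightarrow> int) \<Rightarrow>\<^sub>0 'k) \<Rightarrow> (('n \<Rightarrow> int) \<Rightarrow>\<^sub>0 'k)" where
  "inv_act p e =
     (\<Sum>\<gamma>\<in>Poly_Mapping.keys p. \<Sum>\<delta>\<in>Poly_Mapping.keys e.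
        if (\<lambda>k. int (\<gamma> k)) + \<delta> \<le> 0
        then Poly_Mapping.single ((\<lambda>k. int (\<gamma> k)) + \<delta>)
               (Poly_Mapping.lookup p \<gamma> * Poly_Mapping.lookup e \<delta>)
        else 0)"

definition E_module :: "nat \<Rightarrow> (nat \<Rightarrow>\<^sub>0 (('n \<Rightarrow> int) \<Rightarrow>\<^sub>0 'k::field)) set" where
  "E_module s = {x. Poly_Mapping.keys x \<subseteq> {..<s} \<and> (\<forall>i<s. Poly_Mapping.lookup x i \<in> inv_poly)}"

definition phi_gen ::
  "nat \<Rightarrow> (nat \<Rightarrow> nat \<Rightarrow> 'k::field) \<Rightarrow> (nat \<Rightarrow> 'n \<Rightarrow> nat) \<Rightarrow> (nat \<Rightarrow> 'n \<Rightarrow> nat) \<Rightarrow> nat \<Rightarrow>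
     (nat \<Rightarrow>\<^sub>0 (('n \<Rightarrow> int) \<Rightarrow>\<^sub>0 'k))" where
  "phi_gen s a \<alpha> \<beta> j =
     (\<Sum>i<s. Poly_Mapping.single i
        (Poly_Mapping.single (\<lambda>k. int (\<beta> j k) - int (\<alpha> i k)) (a i j)))"

definition phi ::
  "nat \<Rightarrow> nat \<Rightarrow> (nat \<Rightarrow> nat \<Rightarrow> 'k::field) \<Rightarrow> (nat \<Rightarrow> 'n \<Rightarrow> nat) \<Rightarrow> (nat \<Rightarrow> 'n \<Rightarrow> nat) \<Rightarrow>
     ('n, 'k) pvec \<Rightarrow> (nat \<Rightarrow>\<^sub>0 (('n \<Rightarrow> int) \<Rightarrow>\<^sub>0 'k))" where
  "phi s t a \<alpha> \<beta> x =
     (\<Sum>j<t. Poly_Mapping.map (inv_act (Poly_Mapping.lookup x j)) (phi_gen s a \<alpha> \<beta> j))"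

definition im_matrix ::
  "nat \<Rightarrow> nat \<Rightarrow> (nat \<Rightarrow> nat \<Rightarrow> 'k::field) \<Rightarrow> (nat \<Rightarrow> 'n \<Rightarrow> nat) \<Rightarrow> (nat \<Rightarrow> 'n \<Rightarrow> nat) \<Rightarrow>
     (nat \<Rightarrow>\<^sub>0 (('n \<Rightarrow> int) \<Rightarrow>\<^sub>0 'k)) set" where
  "im_matrix s t a \<alpha> \<beta> = phi s t a \<alpha> \<beta> ` free_module t"

lemma inv_poly_add:
  assumes "x \<in> inv_poly" "y \<in> inv_poly"
  shows "x + y \<in> inv_poly"
  using assms Poly_Mapping.keys_add[of x y] by (auto simp: inv_poly_def)

lemma inv_poly_sum: "(\<And>x. x \<in> S \<Longrightarrow> f x \<in> inv_poly) \<Longrightarrow> sum f S \<in> inv_poly"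
  by (induction S rule: infinite_finite_induct) (auto simp: inv_poly_add, simp_all add: inv_poly_def)

lemma inv_act_in_inv_poly: "inv_act p e \<in> inv_poly"
  unfolding inv_act_def by (intro inv_poly_sum) (auto simp: inv_poly_def)

lemma phi_in_E_module: "phi s t a \<alpha> \<beta> x \<in> E_module s"
proof -
  have lookup: "Poly_Mapping.lookup (phi_gen s a \<alpha> \<beta> j) i = 0" if "\<not> i < s" for i j
    using that by (auto simp: phi_gen_def lookup_sum lookup_single when_def intro!: sum.neutral)
  have "Poly_Mapping.lookup (phi s t a \<alpha> \<beta> x) i \<in> inv_poly" for i
    unfolding phi_def lookup_sum
    by (intro inv_poly_sum)
      (simp add: Poly_Mapping.map.rep_eq when_def inv_act_in_inv_poly, simp add: inv_poly_def)
  moreover have "Poly_Mapping.lookup (phi s t a \<alpha> \<beta> x) i = 0" if "\<not> i < s" for i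
    using lookup[OF that] by (simp add: phi_def lookup_sum Poly_Mapping.map.rep_eq when_def)
  ultimately show ?thesis
    by (auto simp: E_module_def in_keys_iff)
qed

definition gen_E :: "(nat \<Rightarrow> 'n \<Rightarrow> nat) \<Rightarrow> nat \<Rightarrow> 'n \<Rightarrow> ('n, 'k::field) pvec" where
  "gen_E \<alpha> i k = mvec (i, \<lambda>l. if l = k then \<alpha> i k + 1 else 0) 1"

definition G_E :: "nat \<Rightarrow> (nat \<Rightarrow> 'n \<Rightarrow> nat) \<Rightarrow> ('n, 'k::field) pvec set" where
  "G_E s \<alpha> = {gen_E \<alpha> i k | i k. i < s}"

definition U_E :: "nat \<Rightarrow> (nat \<Rightarrow> 'n \<Rightarrow> nat) \<Rightarrow> ('n, 'k::field) pvec set" where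
  "U_E s \<alpha> = R_mod.span (G_E s \<alpha>)"

definition hvec ::
  "nat \<Rightarrow> (nat \<Rightarrow> nat \<Rightarrow> 'k::field) \<Rightarrow> (nat \<Rightarrow> 'n \<Rightarrow> nat) \<Rightarrow> nat \<Rightarrow> ('n, 'k) pvec" where
  "hvec s a \<beta> j = (\<Sum>i<s. mvec (i, \<beta> j) (a i j))"

definition H_A ::
  "nat \<Rightarrow> nat \<Rightarrow> (nat \<Rightarrow> nat \<Rightarrow> 'k::field) \<Rightarrow> (nat \<Rightarrow> 'n \<Rightarrow> nat) \<Rightarrow> ('n, 'k) pvec set" where
  "H_A s t a \<beta> = hvec s a \<beta> ` {..<t}"

definition V_A ::
  "nat \<Rightarrow> nat \<Rightarrow> (nat \<Rightarrow> nat \<Rightarrow> 'k::field) \<Rightarrow> (nat \<Rightarrow> 'n \<Rightarrow> nat) \<Rightarrow> (nat \<Rightarrow> 'n \<Rightarrow> nat) \<Rightarrow>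
     ('n, 'k) pvec set" where
  "V_A s t a \<alpha> \<beta> = R_mod.span (H_A s t a \<beta>) + U_E s \<alpha>"

definition groebner_form ::
  "'n mmon rel \<Rightarrow> nat \<Rightarrow> nat \<Rightarrow> (nat \<Rightarrow> nat \<Rightarrow> 'k::field) \<Rightarrow> (nat \<Rightarrow> 'n \<Rightarrow> nat) \<Rightarrow>
     (nat \<Rightarrow> 'n \<Rightarrow> nat) \<Rightarrow> bool" where
  "groebner_form ord s t a \<alpha> \<beta> \<longleftrightarrow>
     rel_groebner_basis ord (U_E s \<alpha>) (V_A s t a \<alpha> \<beta>) (H_A s t a \<beta>)"

(* One pass through the loop of relative division modulo G by h 0, ..., h (t - 1), on states
   (f, p, q) with q = (q_1, ..., q_t) in R^t. If several elements of G, or several h j, are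
   applicable, any of them may be chosen. *)

type_synonym ('n, 'k) div_state = "('n, 'k) pvec \<times> ('n, 'k) pvec \<times> ('n, 'k) pvec"

inductive div_step ::
  "'n mmon rel \<Rightarrow> ('n, 'k::field) pvec set \<Rightarrow> nat \<Rightarrow> (nat \<Rightarrow> ('n, 'k) pvec) \<Rightarrow>
     ('n, 'k) div_state \<Rightarrow> ('n, 'k) div_state \<Rightarrow> bool"
  for ord G t h where
  reduce_G:
    "\<lbrakk>f \<noteq> 0; g \<in> G; mmon_dvd (lm ord g) (lm ord f)\<rbrakk> \<Longrightarrow>
     div_step ord G t h (f, p, q) (f - vscale (lt_quot ord f g) g, p, q)"
| reduce_h:
    "\<lbrakk>f \<noteq> 0; \<forall>g\<in>G. \<not> mmon_dvd (lm ord g) (lm ord f);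
      j < t; mmon_dvd (lm ord (h j)) (lm ord f)\<rbrakk> \<Longrightarrow>
     div_step ord G t h (f, p, q)
       (f - vscale (lt_quot ord f (h j)) (h j), p,
        q + Poly_Mapping.single j (lt_quot ord f (h j)))"
| move_lt:
    "\<lbrakk>f \<noteq> 0; \<forall>g\<in>G. \<not> mmon_dvd (lm ord g) (lm ord f);
      \<forall>j<t. \<not> mmon_dvd (lm ord (h j)) (lm ord f)\<rbrakk> \<Longrightarrow>
     div_step ord G t h (f, p, q) (f - lt ord f, p + lt ord f, q)"

datatype 'n task = Pair_hh nat nat | Pair_hg nat 'n

definition fp_tasks ::
  "'n mmon rel \<Rightarrow> nat \<Rightarrow> nat \<Rightarrow> (nat \<Rightarrow> nat \<Rightarrow> 'k::field) \<Rightarrow> (nat \<Rightarrow> 'n \<Rightarrow> nat) \<Rightarrow> 'n task set" where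
  "fp_tasks ord s t a \<beta> =
     {Pair_hh j1 j2 | j1 j2. j1 < j2 \<and> j2 < t \<and>
        fst (lm ord (hvec s a \<beta> j1)) = fst (lm ord (hvec s a \<beta> j2))} \<union>
     {Pair_hg j k | j k. j < t}"

fun task_S_vec ::
  "'n mmon rel \<Rightarrow> nat \<Rightarrow> (nat \<Rightarrow> nat \<Rightarrow> 'k::field) \<Rightarrow> (nat \<Rightarrow> 'n \<Rightarrow> nat) \<Rightarrow> (nat \<Rightarrow> 'n \<Rightarrow> nat) \<Rightarrow>
     'n task \<Rightarrow> ('n, 'k) pvec" where
  "task_S_vec ord s a \<alpha> \<beta> (Pair_hh j1 j2) = S_vec ord (hvec s a \<beta> j1) (hvec s a \<beta> j2)"
| "task_S_vec ord s a \<alpha> \<beta> (Pair_hg j k) =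
     S_vec ord (hvec s a \<beta> j) (gen_E \<alpha> (fst (lm ord (hvec s a \<beta> j))) k)"

fun task_sigma ::
  "'n mmon rel \<Rightarrow> nat \<Rightarrow> (nat \<Rightarrow> nat \<Rightarrow> 'k::field) \<Rightarrow> (nat \<Rightarrow> 'n \<Rightarrow> nat) \<Rightarrow> (nat \<Rightarrow> 'n \<Rightarrow> nat) \<Rightarrow>
     'n task \<Rightarrow> ('n, 'k) pvec \<Rightarrow> ('n, 'k) pvec" where
  "task_sigma ord s a \<alpha> \<beta> (Pair_hh j1 j2) q =
     mvec (j1, sup (\<beta> j1) (\<beta> j2) - \<beta> j1) (inverse (lc ord (hvec s a \<beta> j1))) -
     mvec (j2, sup (\<beta> j1) (\<beta> j2) - \<beta> j2) (inverse (lc ord (hvec s a \<beta> j2))) - q"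
| "task_sigma ord s a \<alpha> \<beta> (Pair_hg j k) q =
     (let i = fst (lm ord (hvec s a \<beta> j)) in
        mvec (j, sup (\<beta> j) (\<lambda>l. if l = k then \<alpha> i k + 1 else 0) - \<beta> j)
          (inverse (lc ord (hvec s a \<beta> j))) - q)"

(* FreePresentation as a transition system on configurations (T, d, P): T is the set of pairs
   still to be treated, in any order; d is the division in progress, if any; P is the list of
   columns found so far. *)

type_synonym ('n, 'k) fp_config =
  "'n task set \<times> ('n task \<times> ('n, 'k) div_state) option \<times> ('n, 'k) pvec list"

inductive fp_step ::
  "'n mmon rel \<Rightarrow> nat \<Rightarrow> nat \<Rightarrow> (nat \<Rightarrow> nat \<Rightarrow> 'k::field) \<Rightarrow> (nat \<Rightarrow> 'n \<Rightarrow> nat) \<Rightarrow>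
     (nat \<Rightarrow> 'n \<Rightarrow> nat) \<Rightarrow> ('n, 'k) fp_config \<Rightarrow> ('n, 'k) fp_config \<Rightarrow> bool"
  for ord s t a \<alpha> \<beta> where
  start:
    "\<tau> \<in> T \<Longrightarrow>
     fp_step ord s t a \<alpha> \<beta> (T, None, P)
       (T - {\<tau>}, Some (\<tau>, (task_S_vec ord s a \<alpha> \<beta> \<tau>, 0, 0)), P)"
| divide:
    "div_step ord (G_E s \<alpha>) t (hvec s a \<beta>) d d' \<Longrightarrow>
     fp_step ord s t a \<alpha> \<beta> (T, Some (\<tau>, d), P) (T, Some (\<tau>, d'), P)"
| finish:
    "\<sigma> = task_sigma ord s a \<alpha> \<beta> \<tau> q \<Longrightarrow>
     fp_step ord s t a \<alpha> \<beta> (T, Some (\<tau>, (0, p, q)), P)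
       (T, None, if \<sigma> = 0 then P else P @ [\<sigma>])"

definition fp_init ::
  "'n mmon rel \<Rightarrow> nat \<Rightarrow> nat \<Rightarrow> (nat \<Rightarrow> nat \<Rightarrow> 'k::field) \<Rightarrow> (nat \<Rightarrow> 'n \<Rightarrow> nat) \<Rightarrow> ('n, 'k) fp_config" where
  "fp_init ord s t a \<beta> = (fp_tasks ord s t a \<beta>, None, [])"

definition fp_output ::
  "'n mmon rel \<Rightarrow> nat \<Rightarrow> nat \<Rightarrow> (nat \<Rightarrow> nat \<Rightarrow> 'k::field) \<Rightarrow> (nat \<Rightarrow> 'n \<Rightarrow> nat) \<Rightarrow>
     (nat \<Rightarrow> 'n \<Rightarrow> nat) \<Rightarrow> ('n, 'k) pvec list \<Rightarrow> bool" where
  "fp_output ord s t a \<alpha> \<beta> P \<longleftrightarrow>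
     (fp_step ord s t a \<alpha> \<beta>)\<^sup>*\<^sup>* (fp_init ord s t a \<beta>) ({}, None, P)"

(* There is no infinite run, and a run only stops after having produced an output. *)
definition fp_terminates ::
  "'n mmon rel \<Rightarrow> nat \<Rightarrow> nat \<Rightarrow> (nat \<Rightarrow> nat \<Rightarrow> 'k::field) \<Rightarrow> (nat \<Rightarrow> 'n \<Rightarrow> nat) \<Rightarrow>
     (nat \<Rightarrow> 'n \<Rightarrow> nat) \<Rightarrow> bool" where
  "fp_terminates ord s t a \<alpha> \<beta> \<longleftrightarrow>
     \<not> (\<exists>c :: nat \<Rightarrow> ('n, 'k) fp_config.
          c 0 = fp_init ord s t a \<beta> \<and> (\<forall>i. fp_step ord s t a \<alpha> \<beta> (c i) (c (Suc i)))) \<and>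
     (\<forall>c. (fp_step ord s t a \<alpha> \<beta>)\<^sup>*\<^sup>* (fp_init ord s t a \<beta>) c \<and>
          \<not> (\<exists>c'. fp_step ord s t a \<alpha> \<beta> c c') \<longrightarrow> (\<exists>P. c = ({}, None, P)))"

(* A matrix over R is given by the list of its columns. *)
definition mat_map :: "('n, 'k::field) pvec list \<Rightarrow> ('n, 'k) pvec \<Rightarrow> ('n, 'k) pvec" where
  "mat_map P x = (\<Sum>c<length P. vscale (Poly_Mapping.lookup x c) (P ! c))"

(* exactness of R^r --P--> R^t --f--> M --> 0 *)
definition free_presentation ::
  "nat \<Rightarrow> ('n, 'k::field) pvec list \<Rightarrow> (('n, 'k) pvec \<Rightarrow> 'm::zero) \<Rightarrow> 'm set \<Rightarrow> bool" where
  "free_presentation t P f M \<longleftrightarrow>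
     set P \<subseteq> free_module t \<and>
     mat_map P ` free_module (length P) = {x \<in> free_module t. f x = 0} \<and>
     f ` free_module t = M"

end

theory Submission
  imports Defs
begin

text \<open>
  Write \<open>h\<close> for the map \<open>R^t \<rightarrow> R^s\<close> with \<open>e_j \<mapsto> h_j\<close>. Its coefficients inside the boxes
  \<open>{\<mu>. \<mu> \<le> \<alpha>_i}\<close> are exactly the coefficients of \<open>\<phi>_A\<close>, so the kernel of \<open>\<phi>_A\<close> consists of the
  syzygies of \<open>h_1, \<dots>, h_t\<close> modulo \<open>U_E\<close>: the \<open>x\<close> for which \<open>h(x)\<close> is supported outside the boxes
  (\<open>phi_eq_zero_iff\<close>). It has to be shown that the columns computed by the algorithm are such
  syzygies and generate all of them. This is a relative version of Schreyer's theorem.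

  Give \<open>R^t\<close> the Schreyer order: compare \<open>X^\<gamma> e_j\<close> by the leading monomial of \<open>X^\<gamma> h_j\<close> and break ties
  by \<open>j\<close>. This is again a monomial order, so a submodule of \<open>R^t\<close> is generated by any of its subsets
  whose leading monomials divide the leading monomials of all its non-zero elements
  (\<open>submodule_spanned_if_leading_monomials_divide\<close>).

  The leading monomial of a column is known. By the Groebner hypothesis, relative division of an
  S-vector, which lies in \<open>V_A\<close>, leaves no remainder (\<open>lm_V_divisible\<close>), and all the quotients that
  it collects stay strictly below the monomial at which the two halves of the S-vector cancel. So
  only the two terms, or the single term, from which the S-vector was formed can lead the column.
  In particular no column vanishes (\<open>task_column_properties\<close>).

  Conversely, let a syzygy \<open>x\<close> have leading monomial \<open>X^\<gamma> e_j\<close>, and let \<open>X^\<mu> e_i\<close> be the leading monomial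
  of \<open>X^\<gamma> h_j\<close>. If \<open>\<mu>\<close> lies outside the box of \<open>\<alpha>_i\<close>, some power \<open>X_k^(\<alpha>_ik + 1)\<close> divides \<open>X^\<mu>\<close>, and the
  column of the pair \<open>(j, k)\<close> has a leading monomial dividing \<open>X^\<gamma> e_j\<close>. Otherwise the coefficient of
  \<open>h(x)\<close> at \<open>X^\<mu> e_i\<close> is zero, so some other term of \<open>x\<close> has an image that involves \<open>X^\<mu> e_i\<close>. Its
  component is an \<open>l < j\<close>, and the leading monomial of the column of the pair \<open>(l, j)\<close> divides
  \<open>X^\<gamma> e_j\<close> (\<open>lm_syzygy_divisible\<close>).

  Termination: each step removes a pair, ends a division, or makes the dividend zero or lowers its
  leading monomial in the well-order (\<open>algorithm_step\<close>).
\<close>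

section \<open>Coefficients and supports\<close>

definition mmul :: "('n \<Rightarrow> nat) \<Rightarrow> 'n mmon \<Rightarrow> 'n mmon" where
  "mmul \<mu> m = (fst m, \<mu> + snd m)"

lemma fst_mmul [simp]: "fst (mmul \<mu> m) = fst m"
  and snd_mmul [simp]: "snd (mmul \<mu> m) = \<mu> + snd m"
  by (simp_all add: mmul_def)

lemma mmul_mmul: "mmul \<mu> (mmul \<nu> m) = mmul (\<mu> + \<nu>) m"
  by (simp add: mmul_def add.assoc)

lemma mmul_inj [simp]: "mmul \<mu> m = mmul \<mu> m' \<longleftrightarrow> m = m'"
  by (auto simp: mmul_def prod_eq_iff)

lemma mmon_dvd_iff: "mmon_dvd m m' \<longleftrightarrow> m' = mmul (snd m' - snd m) m"
  by (auto simp: mmon_dvd_def mmul_def prod_eq_iff le_fun_def fun_eq_iff) (metis le_add2)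

lemma vcoeff_zero [simp]: "vcoeff 0 m = 0"
  and vcoeff_add: "vcoeff (f + g) m = vcoeff f m + vcoeff g m"
  and vcoeff_diff: "vcoeff (f - g) m = vcoeff f m - vcoeff g m"
  and vcoeff_sum: "vcoeff (\<Sum>x\<in>X. F x) m = (\<Sum>x\<in>X. vcoeff (F x) m)"
  by (simp_all add: vcoeff_def lookup_add lookup_minus lookup_sum)

lemma vcoeff_mvec: "vcoeff (mvec m c) m' = (if m = m' then c else 0)"
  by (auto simp: vcoeff_def mvec_def lookup_single when_def prod_eq_iff)

lemma pvec_eqI: "(\<And>m. vcoeff f m = vcoeff g m) \<Longrightarrow> f = g"
  by (rule poly_mapping_eqI, rule poly_mapping_eqI) (metis vcoeff_def fst_conv snd_conv)

lemma in_msupp: "m \<in> msupp f \<longleftrightarrow> vcoeff f m \<noteq> 0"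
  by (simp add: msupp_def)

lemma msupp_zero [simp]: "msupp 0 = {}"
  by (simp add: msupp_def)

lemma msupp_empty_iff: "msupp f = {} \<longleftrightarrow> f = 0"
  by (auto simp: msupp_def intro: pvec_eqI)

lemma msupp_mvec: "msupp (mvec m c) = (if c = 0 then {} else {m})"
  by (auto simp: msupp_def vcoeff_mvec)

lemma finite_msupp [simp]: "finite (msupp f)"
proof (rule finite_subset)
  show "msupp f \<subseteq> (SIGMA i:Poly_Mapping.keys f. Poly_Mapping.keys (Poly_Mapping.lookup f i))"
    by (force simp: msupp_def vcoeff_def in_keys_iff)
qed simp

lemma free_module_msupp: "f \<in> free_module s \<longleftrightarrow> (\<forall>m\<in>msupp f. fst m < s)"
proof -
  have "i \<in> Poly_Mapping.keys f \<longleftrightarrow> (\<exists>\<mu>. (i, \<mu>) \<in> msupp f)" for i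
    by (auto simp: in_keys_iff msupp_def vcoeff_def intro!: poly_mapping_eqI)
  then show ?thesis
    by (fastforce simp: free_module_def)
qed

lemma msupp_vscale:
  assumes "m \<in> msupp (vscale p f)"
  obtains \<gamma> m' where "m = mmul \<gamma> m'" "m' \<in> msupp f" "\<gamma> \<in> Poly_Mapping.keys p"
proof -
  have "snd m \<in> Poly_Mapping.keys (p * Poly_Mapping.lookup f (fst m))"
    using assms by (simp add: msupp_def vcoeff_def in_keys_iff)
  then obtain \<gamma> \<delta> where "\<gamma> \<in> Poly_Mapping.keys p" "snd m = \<gamma> + \<delta>"
      "\<delta> \<in> Poly_Mapping.keys (Poly_Mapping.lookup f (fst m))"
    using keys_mult[of p "Poly_Mapping.lookup f (fst m)"] by blast
  then show thesis
    by (intro that[of \<gamma> "(fst m, \<delta>)"])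
      (auto simp: mmul_def prod_eq_iff in_msupp vcoeff_def in_keys_iff)
qed

lemma lookup_single_times:
  fixes p :: "('n, 'k::field) mpoly"
  shows "Poly_Mapping.lookup (Poly_Mapping.single \<gamma> c * p) \<mu> =
    (if \<gamma> \<le> \<mu> then c * Poly_Mapping.lookup p (\<mu> - \<gamma>) else 0)"
proof -
  have "\<mu> = \<gamma> + q \<longleftrightarrow> \<gamma> \<le> \<mu> \<and> q = \<mu> - \<gamma>" for q
    by (auto simp: le_fun_def fun_eq_iff)
  then have "(\<Sum>q. Poly_Mapping.lookup p q when \<mu> = \<gamma> + q) =
      (if \<gamma> \<le> \<mu> then Poly_Mapping.lookup p (\<mu> - \<gamma>) else 0)"
    by (simp add: when_def)
  then show ?thesis
    by (simp add: lookup_mult lookup_single when_mult)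
qed

lemma vcoeff_vscale_single:
  "vcoeff (vscale (Poly_Mapping.single \<gamma> c) f) m =
    (if \<gamma> \<le> snd m then c * vcoeff f (fst m, snd m - \<gamma>) else 0)"
  by (simp add: vcoeff_def lookup_single_times)

lemma vcoeff_vscale_single_mmul:
  "vcoeff (vscale (Poly_Mapping.single \<gamma> c) f) (mmul \<gamma> m) = c * vcoeff f m"
  by (simp add: vcoeff_vscale_single le_fun_def)

text \<open>
  The three submodules described by their monomials below, namely \<open>free_module s\<close>, the vectors
  supported outside the boxes, and those supported on the divisible monomials, are instances.
\<close>
lemma subspace_msupp_in_monomial_submodule:
  assumes "\<And>\<mu> m. m \<in> D \<Longrightarrow> mmul \<mu> m \<in> D"
  shows "R_mod.subspace {f :: ('n, 'k::field) pvec. msupp f \<subseteq> D}"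
proof (rule R_mod.subspaceI)
  fix f g :: "('n, 'k) pvec"
  assume "f \<in> {f. msupp f \<subseteq> D}" "g \<in> {f. msupp f \<subseteq> D}"
  then show "f + g \<in> {f. msupp f \<subseteq> D}"
    by (fastforce simp: msupp_def vcoeff_add)
next
  fix p and f :: "('n, 'k) pvec"
  assume "f \<in> {f. msupp f \<subseteq> D}"
  then show "vscale p f \<in> {f. msupp f \<subseteq> D}"
    using assms by (auto elim!: msupp_vscale)
qed simp

lemma subspace_free_module: "R_mod.subspace (free_module s :: ('n, 'k::field) pvec set)"
proof -
  have "free_module s = {f :: ('n, 'k::field) pvec. msupp f \<subseteq> {m. fst m < s}}"
    by (force simp: free_module_msupp)
  then show ?thesis
    using subspace_msupp_in_monomial_submodule[of "{m. fst m < s}"] by simp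
qed

text \<open>
  Spans over the field, such as \<open>lm_space\<close>, are bounded by submodules in the same way as spans over
  the polynomial ring.
\<close>
lemma k_span_subset:
  assumes "S \<subseteq> W" "R_mod.subspace W"
  shows "k_mod.span S \<subseteq> W"
  using assms(2) by (intro k_mod.span_minimal[OF assms(1)] k_mod.subspaceI)
    (auto simp: kscale_def R_mod.subspace_0 R_mod.subspace_add R_mod.subspace_scale)

section \<open>Leading monomials\<close>

locale module_order =
  fixes s :: nat and ord :: "'n mmon rel"
  assumes monomial_order: "monomial_order s ord"
begin

lemma ord_well_order: "well_order_on {m. fst m < s} ord"
  using monomial_order by (simp add: monomial_order_def)

lemma ord_field: "(m, m') \<in> ord \<Longrightarrow> fst m < s \<and> fst m' < s"
  using ord_well_order by (auto simp: order_on_defs)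

lemma ord_refl: "fst m < s \<Longrightarrow> (m, m) \<in> ord"
  using ord_well_order by (cases m) (auto simp: order_on_defs refl_on_def)

lemma ord_trans: "(m, m') \<in> ord \<Longrightarrow> (m', m'') \<in> ord \<Longrightarrow> (m, m'') \<in> ord"
  using ord_well_order by (auto simp: order_on_defs dest: transD)

lemma ord_antisym: "(m, m') \<in> ord \<Longrightarrow> (m', m) \<in> ord \<Longrightarrow> m = m'"
  using ord_well_order by (auto simp: order_on_defs dest: antisymD)

lemma ord_total: "fst m < s \<Longrightarrow> fst m' < s \<Longrightarrow> (m, m') \<in> ord \<or> (m', m) \<in> ord"
  using ord_well_order ord_refl[of m] unfolding order_on_defs total_on_def by (metis mem_Collect_eq)

lemma ord_wf: "wf (ord - Id)"
  using ord_well_order by (simp add: order_on_defs)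

lemma ord_mmul: "(m, m') \<in> ord \<Longrightarrow> (mmul \<mu> m, mmul \<mu> m') \<in> ord"
  using monomial_order by (cases m; cases m') (auto simp: monomial_order_def mmul_def)

lemma ord_finite_max:
  assumes "finite A" "A \<noteq> {}" "\<And>m. m \<in> A \<Longrightarrow> fst m < s"
  shows "\<exists>m\<in>A. \<forall>m'\<in>A. (m', m) \<in> ord"
  using assms
proof (induction rule: finite_ne_induct)
  case (insert x A)
  then obtain m where "m \<in> A" "\<forall>m'\<in>A. (m', m) \<in> ord"
    by auto
  then show ?case
    using insert.prems ord_total[of x m] ord_trans ord_refl by (metis insert_iff)
qed (auto intro: ord_refl)

text \<open>
  Bounds for all monomials at once, rather than a comparison of leading monomials, include the zero
  vector and are closed under sums.
\<close>
definition bounded_by :: "'n mmon \<Rightarrow> ('n, 'k::field) pvec \<Rightarrow> bool" where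
  "bounded_by B f \<longleftrightarrow> (\<forall>m\<in>msupp f. (m, B) \<in> ord)"

definition strictly_bounded_by :: "'n mmon \<Rightarrow> ('n, 'k::field) pvec \<Rightarrow> bool" where
  "strictly_bounded_by B f \<longleftrightarrow> (\<forall>m\<in>msupp f. (m, B) \<in> ord - Id)"

lemma lm_eqI: "m \<in> msupp f \<Longrightarrow> bounded_by m f \<Longrightarrow> lm ord f = m"
  unfolding lm_def bounded_by_def by (rule the_equality) (auto intro: ord_antisym)

lemma lm_props:
  assumes "f \<in> free_module s" "f \<noteq> 0"
  shows lm_in_msupp: "lm ord f \<in> msupp f" and bounded_by_lm: "bounded_by (lm ord f) f"
proof -
  obtain m where "m \<in> msupp f" "bounded_by m f"
    using ord_finite_max[of "msupp f"] assms
    by (auto simp: msupp_empty_iff free_module_msupp bounded_by_def)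
  then show "lm ord f \<in> msupp f" "bounded_by (lm ord f) f"
    using lm_eqI by metis+
qed

lemma fst_lm_less: "f \<in> free_module s \<Longrightarrow> f \<noteq> 0 \<Longrightarrow> fst (lm ord f) < s"
  using lm_in_msupp by (auto simp: free_module_msupp)

lemma lc_nonzero: "f \<in> free_module s \<Longrightarrow> f \<noteq> 0 \<Longrightarrow> lc ord f \<noteq> 0"
  using lm_in_msupp[of f] by (simp add: lc_def in_msupp)

lemma lm_mvec: "fst m < s \<Longrightarrow> c \<noteq> 0 \<Longrightarrow> lm ord (mvec m c) = m"
  by (rule lm_eqI) (auto simp: msupp_mvec bounded_by_def intro: ord_refl)

lemma bounded_by_vscale:
  assumes "bounded_by m f"
  shows "bounded_by (mmul \<gamma> m) (vscale (Poly_Mapping.single \<gamma> c) f)"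
  unfolding bounded_by_def
proof
  fix m' assume "m' \<in> msupp (vscale (Poly_Mapping.single \<gamma> c) f)"
  then obtain m'' where "m' = mmul \<gamma> m''" "m'' \<in> msupp f"
    by (auto elim!: msupp_vscale split: if_splits)
  then show "(m', mmul \<gamma> m) \<in> ord"
    using assms by (auto simp: bounded_by_def intro: ord_mmul)
qed

lemma strictly_bounded_by_cancel:
  assumes "bounded_by B f" "bounded_by B g" "vcoeff f B = vcoeff g B"
  shows "strictly_bounded_by B (f - g)"
  unfolding strictly_bounded_by_def
proof
  fix m assume m: "m \<in> msupp (f - g)"
  then have "m \<noteq> B"
    using assms(3) by (auto simp: in_msupp vcoeff_diff)
  moreover have "m \<in> msupp f \<or> m \<in> msupp g"
    using m by (auto simp: in_msupp vcoeff_diff)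
  ultimately show "(m, B) \<in> ord - Id"
    using assms(1,2) by (auto simp: bounded_by_def)
qed

lemma strictly_bounded_by_lm:
  assumes "strictly_bounded_by B f" "f \<in> free_module s" "f \<noteq> 0"
  shows "(lm ord f, B) \<in> ord - Id"
  using assms lm_in_msupp by (auto simp: strictly_bounded_by_def)

text \<open>
  Both vectors have leading term \<open>lt f\<close>; so it cancels, and all other monomials were smaller already.
\<close>
lemma reduction_step:
  assumes f: "f \<in> free_module s" "f \<noteq> 0" and g: "g \<in> free_module s" "g \<noteq> 0"
    and dvd: "mmon_dvd (lm ord g) (lm ord f)"
  shows "strictly_bounded_by (lm ord f) (f - vscale (lt_quot ord f g) g)"
proof (rule strictly_bounded_by_cancel)
  let ?\<gamma> = "snd (lm ord f) - snd (lm ord g)"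
  have eq: "lm ord f = mmul ?\<gamma> (lm ord g)"
    using dvd by (simp add: mmon_dvd_iff)
  show "bounded_by (lm ord f) f"
    by (rule bounded_by_lm[OF f])
  show "bounded_by (lm ord f) (vscale (lt_quot ord f g) g)"
    unfolding lt_quot_def by (subst eq) (rule bounded_by_vscale[OF bounded_by_lm[OF g]])
  have "vcoeff (vscale (lt_quot ord f g) g) (mmul ?\<gamma> (lm ord g)) = lc ord f / lc ord g * lc ord g"
    unfolding lt_quot_def lc_def by (rule vcoeff_vscale_single_mmul)
  then show "vcoeff f (lm ord f) = vcoeff (vscale (lt_quot ord f g) g) (lm ord f)"
    using lc_nonzero[OF g] eq by (simp add: lc_def)
qed

text \<open>
  Reducing \<open>x\<close> by a suitable element of \<open>D\<close> stays in \<open>K\<close> and lowers the leading monomial; a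
  well-order does not allow this to go on forever.
\<close>
lemma submodule_spanned_if_leading_monomials_divide:
  assumes K: "R_mod.subspace K" "K \<subseteq> free_module s" and D: "D \<subseteq> K"
    and div: "\<And>x. x \<in> K \<Longrightarrow> x \<noteq> 0 \<Longrightarrow> \<exists>d\<in>D - {0}. mmon_dvd (lm ord d) (lm ord x)"
  shows "K \<subseteq> R_mod.span D"
proof -
  have "\<forall>x\<in>K. x \<noteq> 0 \<longrightarrow> lm ord x = m \<longrightarrow> x \<in> R_mod.span D" for m
  proof (induction m rule: wf_induct_rule[OF ord_wf])
    case (1 m)
    show ?case
    proof (intro ballI impI)
      fix x assume x: "x \<in> K" "x \<noteq> 0" "lm ord x = m"
      then obtain d where d: "d \<in> D" "d \<noteq> 0" "mmon_dvd (lm ord d) (lm ord x)"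
        using div by blast
      define y where "y = x - vscale (lt_quot ord x d) d"
      have y: "y \<in> K"
        unfolding y_def using K(1) x d D
        by (auto intro!: R_mod.subspace_diff R_mod.subspace_scale)
      have "strictly_bounded_by m y"
        unfolding y_def x(3)[symmetric] using x d K D by (intro reduction_step) auto
      then have "y \<noteq> 0 \<Longrightarrow> (lm ord y, m) \<in> ord - Id"
        using y K(2) by (intro strictly_bounded_by_lm) auto
      then have "y \<in> R_mod.span D"
        using 1[of "lm ord y"] y by (cases "y = 0") (simp_all only: R_mod.span_zero, metis)
      moreover have "x = y + vscale (lt_quot ord x d) d"
        by (simp add: y_def)
      ultimately show "x \<in> R_mod.span D"
        using d(1) by (metis R_mod.span_add R_mod.span_base R_mod.span_scale)
    qed
  qed
  then show ?thesis
    by (metis R_mod.span_zero subsetI)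
qed

text \<open>
  Both scaled vectors have the lcm as leading monomial, with coefficient \<open>1\<close>, so it cancels.
\<close>
lemma S_vec_strictly_bounded_by:
  assumes f: "f \<in> free_module s" "f \<noteq> 0" and g: "g \<in> free_module s" "g \<noteq> 0"
    and comp: "fst (lm ord f) = fst (lm ord g)"
  shows "strictly_bounded_by (fst (lm ord f), sup (snd (lm ord f)) (snd (lm ord g))) (S_vec ord f g)"
proof -
  let ?B = "(fst (lm ord f), sup (snd (lm ord f)) (snd (lm ord g)))"
  have normalized:
    "bounded_by ?B (vscale (Poly_Mapping.single (snd ?B - snd (lm ord u)) (inverse (lc ord u))) u)
     \<and> vcoeff (vscale (Poly_Mapping.single (snd ?B - snd (lm ord u)) (inverse (lc ord u))) u) ?B = 1"
    if u: "u \<in> free_module s" "u \<noteq> 0" and dvd: "mmon_dvd (lm ord u) ?B"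
    for u
  proof -
    have eq: "?B = mmul (snd ?B - snd (lm ord u)) (lm ord u)"
      using dvd by (simp only: mmon_dvd_iff)
    have "bounded_by (mmul (snd ?B - snd (lm ord u)) (lm ord u))
        (vscale (Poly_Mapping.single (snd ?B - snd (lm ord u)) (inverse (lc ord u))) u)"
      by (rule bounded_by_vscale[OF bounded_by_lm[OF u]])
    moreover have "vcoeff
        (vscale (Poly_Mapping.single (snd ?B - snd (lm ord u)) (inverse (lc ord u))) u)
        (mmul (snd ?B - snd (lm ord u)) (lm ord u)) = inverse (lc ord u) * lc ord u"
      unfolding lc_def by (rule vcoeff_vscale_single_mmul)
    ultimately show ?thesis
      unfolding eq[symmetric] using lc_nonzero[OF u] by simp
  qed
  show ?thesis
    unfolding S_vec_def Let_def
    using normalized[OF f] normalized[OF g] comp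
    by (intro strictly_bounded_by_cancel) (auto simp: mmon_dvd_def)
qed

end

section \<open>The map of free modules and the map to the injective module\<close>

lemma mat_map_zero [simp]: "mat_map P 0 = 0"
  and mat_map_add: "mat_map P (x + y) = mat_map P x + mat_map P y"
  and mat_map_diff: "mat_map P (x - y) = mat_map P x - mat_map P y"
  and mat_map_vscale: "mat_map P (vscale p x) = vscale p (mat_map P x)"
  by (simp_all add: mat_map_def lookup_add lookup_minus R_mod.scale_left_distrib sum.distrib
      R_mod.scale_left_diff_distrib sum_subtractf R_mod.scale_sum_right)

lemma mat_map_mvec:
  assumes "c < length P"
  shows "mat_map P (mvec (c, \<gamma>) d) = vscale (Poly_Mapping.single \<gamma> d) (P ! c)"
proof -
  have "mat_map P (mvec (c, \<gamma>) d) =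
      (\<Sum>c'<length P. if c = c' then vscale (Poly_Mapping.single \<gamma> d) (P ! c) else 0)"
    unfolding mat_map_def by (intro sum.cong) (auto simp: mvec_def lookup_single when_def)
  also have "\<dots> = vscale (Poly_Mapping.single \<gamma> d) (P ! c)"
    using assms by (simp add: sum.delta)
  finally show ?thesis .
qed

lemma image_mat_map: "mat_map P ` free_module (length P) = R_mod.span (set P)"
proof
  show "mat_map P ` free_module (length P) \<subseteq> R_mod.span (set P)"
    unfolding mat_map_def
    by (rule image_subsetI, intro R_mod.span_sum R_mod.span_scale R_mod.span_base) simp
next
  have "set P \<subseteq> mat_map P ` free_module (length P)"
  proof
    fix v assume "v \<in> set P"
    then obtain c where c: "c < length P" "v = P ! c"
      by (metis in_set_conv_nth)
    then have "v = mat_map P (mvec (c, 0) 1)"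
      by (simp add: mat_map_mvec)
    moreover have "mvec (c, 0) 1 \<in> free_module (length P)"
      using c(1) by (simp add: free_module_msupp msupp_mvec)
    ultimately show "v \<in> mat_map P ` free_module (length P)"
      by (rule image_eqI)
  qed
  moreover have "R_mod.subspace (mat_map P ` free_module (length P))"
  proof (rule R_mod.subspaceI)
    show "0 \<in> mat_map P ` free_module (length P)"
      using R_mod.subspace_0[OF subspace_free_module] by (metis image_eqI mat_map_zero)
  next
    fix x y assume "x \<in> mat_map P ` free_module (length P)" "y \<in> mat_map P ` free_module (length P)"
    then show "x + y \<in> mat_map P ` free_module (length P)"
      using R_mod.subspace_add[OF subspace_free_module] by (auto simp flip: mat_map_add intro!: imageI)
  next
    fix p x assume "x \<in> mat_map P ` free_module (length P)"
    then show "vscale p x \<in> mat_map P ` free_module (length P)"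
      using R_mod.subspace_scale[OF subspace_free_module] by (auto simp flip: mat_map_vscale intro!: imageI)
  qed
  ultimately show "R_mod.span (set P) \<subseteq> mat_map P ` free_module (length P)"
    by (rule R_mod.span_minimal)
qed

lemma lookup_hvec:
  "Poly_Mapping.lookup (hvec s a \<beta> j) i = Poly_Mapping.single (\<beta> j) (if i < s then a i j else 0)"
proof -
  have "Poly_Mapping.lookup (hvec s a \<beta> j) i =
      (\<Sum>i'<s. if i' = i then Poly_Mapping.single (\<beta> j) (a i j) else 0)"
    unfolding hvec_def lookup_sum by (intro sum.cong) (auto simp: mvec_def lookup_single when_def)
  then show ?thesis
    by (simp add: sum.delta')
qed

lemma vcoeff_hvec:
  "vcoeff (hvec s a \<beta> j) m = (if fst m < s \<and> snd m = \<beta> j then a (fst m) j else 0)"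
  by (auto simp: vcoeff_def lookup_hvec lookup_single when_def)

abbreviation H_map ::
  "nat \<Rightarrow> nat \<Rightarrow> (nat \<Rightarrow> nat \<Rightarrow> 'k::field) \<Rightarrow> (nat \<Rightarrow> 'n \<Rightarrow> nat) \<Rightarrow> ('n, 'k) pvec \<Rightarrow> ('n, 'k) pvec"
where
  "H_map s t a \<beta> \<equiv> mat_map (map (hvec s a \<beta>) [0..<t])"

lemma vcoeff_H_map:
  "vcoeff (H_map s t a \<beta> x) m =
    (\<Sum>j<t. if \<beta> j \<le> snd m then vcoeff x (j, snd m - \<beta> j) * (if fst m < s then a (fst m) j else 0)
      else 0)"
proof -
  have "vcoeff (vscale p (hvec s a \<beta> j)) m =
      (if \<beta> j \<le> snd m then Poly_Mapping.lookup p (snd m - \<beta> j) * (if fst m < s then a (fst m) j else 0)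
       else 0)" for p j
    by (simp add: vcoeff_def lookup_hvec mult.commute[of p] lookup_single_times)
  then show ?thesis
    unfolding mat_map_def vcoeff_sum by (simp add: vcoeff_def cong: if_cong)
qed

lemma inv_act_zero [simp]: "inv_act p 0 = 0"
  by (simp add: inv_act_def)

text \<open>
  In this form the formula also covers \<open>c = 0\<close>, where the support of the second argument is empty.
\<close>
lemma inv_act_single:
  "inv_act p (Poly_Mapping.single \<epsilon> c) =
    (\<Sum>\<gamma>\<in>Poly_Mapping.keys p. if (\<lambda>k. int (\<gamma> k)) + \<epsilon> \<le> 0
      then Poly_Mapping.single ((\<lambda>k. int (\<gamma> k)) + \<epsilon>) (Poly_Mapping.lookup p \<gamma> * c) else 0)"
  by (cases "c = 0") (auto simp: inv_act_def intro!: sum.cong sum.neutral)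

text \<open>
  The element \<open>c X^(\<beta> - \<alpha>)\<close> of the injective hull corresponds to \<open>c X^\<beta>\<close>: shifting degrees by \<open>\<alpha>\<close> turns
  the action of \<open>p\<close> into multiplication, truncated to the box \<open>{\<mu>. \<mu> \<le> \<alpha>}\<close>.
\<close>
lemma lookup_inv_act_single:
  fixes \<alpha> \<beta> \<mu> :: "'n \<Rightarrow> nat"
  assumes "\<mu> \<le> \<alpha>"
  shows "Poly_Mapping.lookup (inv_act p (Poly_Mapping.single (\<lambda>k. int (\<beta> k) - int (\<alpha> k)) c))
      (\<lambda>k. int (\<mu> k) - int (\<alpha> k)) =
    (if \<beta> \<le> \<mu> then Poly_Mapping.lookup p (\<mu> - \<beta>) * c else 0)"
proof -
  have eq: "(\<lambda>k. int (\<gamma> k)) + (\<lambda>k. int (\<beta> k) - int (\<alpha> k)) = (\<lambda>k. int (\<mu> k) - int (\<alpha> k))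
      \<longleftrightarrow> \<beta> \<le> \<mu> \<and> \<gamma> = \<mu> - \<beta>" for \<gamma> :: "'n \<Rightarrow> nat"
  proof -
    have "int (\<gamma> k) + (int (\<beta> k) - int (\<alpha> k)) = int (\<mu> k) - int (\<alpha> k)
        \<longleftrightarrow> \<beta> k \<le> \<mu> k \<and> \<gamma> k = \<mu> k - \<beta> k" for k
      by linarith
    then show ?thesis
      by (auto simp: fun_eq_iff le_fun_def)
  qed
  have nonpos: "(\<lambda>k. int (\<mu> k) - int (\<alpha> k)) \<le> 0"
    using assms by (simp add: le_fun_def)
  have "Poly_Mapping.lookup (inv_act p (Poly_Mapping.single (\<lambda>k. int (\<beta> k) - int (\<alpha> k)) c))
      (\<lambda>k. int (\<mu> k) - int (\<alpha> k)) =
    (\<Sum>\<gamma>\<in>Poly_Mapping.keys p. if \<gamma> = \<mu> - \<beta> then if \<beta> \<le> \<mu> then Poly_Mapping.lookup p \<gamma> * c else 0 else 0)"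
    unfolding inv_act_single lookup_sum
  proof (intro sum.cong refl)
    fix \<gamma> :: "'n \<Rightarrow> nat"
    show "Poly_Mapping.lookup (if (\<lambda>k. int (\<gamma> k)) + (\<lambda>k. int (\<beta> k) - int (\<alpha> k)) \<le> 0
        then Poly_Mapping.single ((\<lambda>k. int (\<gamma> k)) + (\<lambda>k. int (\<beta> k) - int (\<alpha> k)))
          (Poly_Mapping.lookup p \<gamma> * c) else 0) (\<lambda>k. int (\<mu> k) - int (\<alpha> k)) =
      (if \<gamma> = \<mu> - \<beta> then if \<beta> \<le> \<mu> then Poly_Mapping.lookup p \<gamma> * c else 0 else 0)"
      using eq[of \<gamma>] nonpos
      by (cases "(\<lambda>k. int (\<gamma> k)) + (\<lambda>k. int (\<beta> k) - int (\<alpha> k)) = (\<lambda>k. int (\<mu> k) - int (\<alpha> k))")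
        (auto simp: lookup_single when_def)
  qed
  then show ?thesis
    by (simp add: sum.delta in_keys_iff)
qed

lemma lookup_inv_act_single_nonzero:
  fixes \<alpha> \<beta> :: "'n \<Rightarrow> nat"
  assumes "Poly_Mapping.lookup (inv_act p (Poly_Mapping.single (\<lambda>k. int (\<beta> k) - int (\<alpha> k)) c)) \<delta> \<noteq> 0"
  shows "\<exists>\<mu>\<le>\<alpha>. \<delta> = (\<lambda>k. int (\<mu> k) - int (\<alpha> k))"
proof -
  obtain \<gamma> where nonpos: "(\<lambda>k. int (\<gamma> k)) + (\<lambda>k. int (\<beta> k) - int (\<alpha> k)) \<le> 0"
    and \<delta>: "\<delta> = (\<lambda>k. int (\<gamma> k)) + (\<lambda>k. int (\<beta> k) - int (\<alpha> k))"
    using assms unfolding inv_act_single lookup_sum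
    by (auto simp: lookup_single when_def elim!: sum.not_neutral_contains_not_neutral split: if_splits)
  have "\<gamma> + \<beta> \<le> \<alpha>"
  proof (rule le_funI)
    fix k
    have "int (\<gamma> k) + (int (\<beta> k) - int (\<alpha> k)) \<le> 0"
      using le_funD[OF nonpos, of k] by simp
    then show "(\<gamma> + \<beta>) k \<le> \<alpha> k"
      by simp
  qed
  moreover have "\<delta> = (\<lambda>k. int ((\<gamma> + \<beta>) k) - int (\<alpha> k))"
    unfolding \<delta> by (auto simp: fun_eq_iff)
  ultimately show ?thesis
    by blast
qed

lemma lookup_phi_gen:
  "Poly_Mapping.lookup (phi_gen s a \<alpha> \<beta> j) i =
    Poly_Mapping.single (\<lambda>k. int (\<beta> j k) - int (\<alpha> i k)) (if i < s then a i j else 0)"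
proof -
  have "Poly_Mapping.lookup (phi_gen s a \<alpha> \<beta> j) i =
      (\<Sum>i'<s. if i' = i then Poly_Mapping.single (\<lambda>k. int (\<beta> j k) - int (\<alpha> i k)) (a i j) else 0)"
    unfolding phi_gen_def lookup_sum by (intro sum.cong) (auto simp: lookup_single when_def)
  then show ?thesis
    by (simp add: sum.delta')
qed

lemma lookup_phi:
  "Poly_Mapping.lookup (phi s t a \<alpha> \<beta> x) i =
    (\<Sum>j<t. inv_act (Poly_Mapping.lookup x j)
      (Poly_Mapping.single (\<lambda>k. int (\<beta> j k) - int (\<alpha> i k)) (if i < s then a i j else 0)))"
  unfolding phi_def lookup_sum
  by (intro sum.cong refl)
    (auto simp: Poly_Mapping.map.rep_eq lookup_phi_gen when_def)

text \<open>
  The isomorphism of \<open>R^s / U_E\<close> with the part of \<open>E\<close> in non-negative degrees, in the form in which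
  it is used: the coefficients of \<open>phi x\<close> are the coefficients of \<open>H_map x\<close> inside the boxes.
\<close>
lemma phi_eq_zero_iff:
  "phi s t a \<alpha> \<beta> x = 0 \<longleftrightarrow> (\<forall>m\<in>msupp (H_map s t a \<beta> x). \<not> snd m \<le> \<alpha> (fst m))"
proof -
  have coeff: "Poly_Mapping.lookup (Poly_Mapping.lookup (phi s t a \<alpha> \<beta> x) i) (\<lambda>k. int (\<mu> k) - int (\<alpha> i k))
      = vcoeff (H_map s t a \<beta> x) (i, \<mu>)" if "\<mu> \<le> \<alpha> i" for i \<mu>
    unfolding lookup_phi lookup_sum vcoeff_H_map
    by (intro sum.cong) (auto simp: vcoeff_def lookup_inv_act_single[OF that])
  show ?thesis
  proof
    assume "phi s t a \<alpha> \<beta> x = 0"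
    then show "\<forall>m\<in>msupp (H_map s t a \<beta> x). \<not> snd m \<le> \<alpha> (fst m)"
      using coeff by (auto simp: in_msupp)
  next
    assume out: "\<forall>m\<in>msupp (H_map s t a \<beta> x). \<not> snd m \<le> \<alpha> (fst m)"
    have "Poly_Mapping.lookup (Poly_Mapping.lookup (phi s t a \<alpha> \<beta> x) i) \<delta> = 0" for i \<delta>
    proof (rule ccontr)
      assume nz: "Poly_Mapping.lookup (Poly_Mapping.lookup (phi s t a \<alpha> \<beta> x) i) \<delta> \<noteq> 0"
      then obtain \<mu> where "\<mu> \<le> \<alpha> i" "\<delta> = (\<lambda>k. int (\<mu> k) - int (\<alpha> i k))"
        unfolding lookup_phi lookup_sum
        by (auto elim!: sum.not_neutral_contains_not_neutral dest!: lookup_inv_act_single_nonzero)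
      then have "(i, \<mu>) \<in> msupp (H_map s t a \<beta> x)"
        using nz by (simp add: in_msupp coeff)
      with out \<open>\<mu> \<le> \<alpha> i\<close> show False
        by force
    qed
    then show "phi s t a \<alpha> \<beta> x = 0"
      by (intro poly_mapping_eqI) simp
  qed
qed

section \<open>Matrices in Groebner form\<close>

locale groebner_matrix = module_order s ord
  for s :: nat and ord :: "'n::finite mmon rel" +
  fixes t :: nat and a :: "nat \<Rightarrow> nat \<Rightarrow> 'k::field" and \<alpha> \<beta> :: "nat \<Rightarrow> 'n \<Rightarrow> nat"
  assumes groebner_form: "groebner_form ord s t a \<alpha> \<beta>"
begin

abbreviation h :: "nat \<Rightarrow> ('n, 'k) pvec" where "h \<equiv> hvec s a \<beta>"
abbreviation G :: "('n, 'k) pvec set" where "G \<equiv> G_E s \<alpha>"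
abbreviation U :: "('n, 'k) pvec set" where "U \<equiv> U_E s \<alpha>"
abbreviation V :: "('n, 'k) pvec set" where "V \<equiv> V_A s t a \<alpha> \<beta>"
abbreviation outside :: "'n mmon \<Rightarrow> bool" where "outside m \<equiv> \<not> snd m \<le> \<alpha> (fst m)"

lemma subspace_U: "R_mod.subspace U"
  by (simp add: U_E_def)

lemma outside_mmul: "outside m \<Longrightarrow> outside (mmul \<mu> m)"
  by (auto simp: le_fun_def intro: add_leD2)

lemma subspace_outside: "R_mod.subspace {f :: ('n, 'k) pvec. msupp f \<subseteq> {m. outside m}}"
  by (rule subspace_msupp_in_monomial_submodule, rule CollectI, rule outside_mmul, drule CollectD)

lemma U_outside: "U \<subseteq> {f. msupp f \<subseteq> {m. outside m}}"
  unfolding U_E_def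
proof (rule R_mod.span_minimal[OF _ subspace_outside])
  have "\<not> (\<lambda>l. if l = k then \<alpha> i k + 1 else 0) \<le> \<alpha> i" for i k
  proof
    assume "(\<lambda>l. if l = k then \<alpha> i k + 1 else 0) \<le> \<alpha> i"
    from le_funD[OF this, of k] show False by simp
  qed
  then show "G \<subseteq> {f. msupp f \<subseteq> {m. outside m}}"
    by (auto simp: G_E_def gen_E_def msupp_mvec)
qed

lemma V_eq: "V = R_mod.span (h ` {..<t} \<union> G)"
  unfolding V_A_def U_E_def H_A_def R_mod.span_Un set_plus_def by auto

lemma subspace_V: "R_mod.subspace V"
  by (simp add: V_eq)

lemma h_in_V: "j < t \<Longrightarrow> h j \<in> V"
  unfolding V_eq by (intro R_mod.span_base) auto

lemma G_in_V: "g \<in> G \<Longrightarrow> g \<in> V"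
  unfolding V_eq by (intro R_mod.span_base) auto

lemma G_in_U: "g \<in> G \<Longrightarrow> g \<in> U"
  unfolding U_E_def by (intro R_mod.span_base)

lemma h_free: "h j \<in> free_module s"
  by (auto simp: free_module_msupp in_msupp vcoeff_hvec split: if_splits)

lemma G_free: "g \<in> G \<Longrightarrow> g \<in> free_module s"
  by (auto simp: free_module_msupp msupp_mvec G_E_def gen_E_def)

lemma V_free: "V \<subseteq> free_module s"
  unfolding V_eq using h_free G_free by (intro R_mod.span_minimal subspace_free_module) auto

lemma G_nonzero: "g \<in> G \<Longrightarrow> g \<noteq> 0"
  by (auto simp: G_E_def gen_E_def msupp_mvec simp flip: msupp_empty_iff)

lemma h_nonzero: "j < t \<Longrightarrow> h j \<noteq> 0"
  using groebner_form R_mod.subspace_0[OF subspace_U]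
  unfolding groebner_form_def rel_groebner_basis_def H_A_def by fastforce

lemma snd_lm_h: "j < t \<Longrightarrow> snd (lm ord (h j)) = \<beta> j"
  using lm_in_msupp[OF h_free h_nonzero, of j] by (auto simp: in_msupp vcoeff_hvec split: if_splits)

lemma fst_lm_h: "j < t \<Longrightarrow> fst (lm ord (h j)) < s"
  by (rule fst_lm_less[OF h_free h_nonzero])

lemma gen_E_in_G: "i < s \<Longrightarrow> gen_E \<alpha> i k \<in> G"
  by (auto simp: G_E_def)

lemma lm_gen_E: "i < s \<Longrightarrow> lm ord (gen_E \<alpha> i k :: ('n, 'k) pvec) = (i, \<lambda>l. if l = k then \<alpha> i k + 1 else 0)"
  unfolding gen_E_def by (rule lm_mvec) simp_all

lemma outside_divisible_by_G:
  assumes "outside m" "fst m < s"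
  shows "\<exists>g\<in>G. mmon_dvd (lm ord g) m"
proof -
  obtain k where "\<alpha> (fst m) k < snd m k"
    using assms(1) by (auto simp: le_fun_def not_le)
  then have "mmon_dvd (lm ord (gen_E \<alpha> (fst m) k :: ('n, 'k) pvec)) m"
    using assms(2) by (auto simp: lm_gen_E mmon_dvd_def le_fun_def)
  then show ?thesis
    using gen_E_in_G[OF assms(2)] by blast
qed

text \<open>
  This is what the Groebner property gives to the division algorithm. The vectors supported on
  monomials that are outside the boxes or divisible by some \<open>lm (h j)\<close> form a submodule, which
  contains both summands of \<open>lm_space ord V\<close>.
\<close>
lemma lm_V_divisible:
  assumes "v \<in> V" "v \<noteq> 0"
  shows "(\<exists>j<t. mmon_dvd (lm ord (h j)) (lm ord v)) \<or> (\<exists>g\<in>G. mmon_dvd (lm ord g) (lm ord v))"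
proof -
  define D where "D = {m. (\<exists>j<t. mmon_dvd (lm ord (h j)) m) \<or> outside m}"
  have sub: "R_mod.subspace {f :: ('n, 'k) pvec. msupp f \<subseteq> D}"
  proof (rule subspace_msupp_in_monomial_submodule)
    fix \<mu> and m :: "'n mmon" assume "m \<in> D"
    moreover have "mmon_dvd m' m \<Longrightarrow> mmon_dvd m' (mmul \<mu> m)" for m'
      by (auto simp: mmon_dvd_def le_fun_def intro: trans_le_add2)
    ultimately show "mmul \<mu> m \<in> D"
      unfolding D_def using outside_mmul[of m \<mu>] by blast
  qed
  have "R_mod.span {mvec (lm ord h') 1 :: ('n, 'k) pvec | h'. h' \<in> H_A s t a \<beta>} \<subseteq> {f. msupp f \<subseteq> D}"
    by (rule R_mod.span_minimal[OF _ sub]) (auto simp: msupp_mvec D_def H_A_def mmon_dvd_def)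
  moreover have "lm_space ord U \<subseteq> {f. msupp f \<subseteq> D}"
    unfolding lm_space_def
  proof (rule k_span_subset[OF _ sub])
    have "outside (lm ord u)" if "u \<in> U" "u \<noteq> 0" for u
    proof -
      have "u \<in> free_module s"
        using that(1) R_mod.span_minimal[OF _ subspace_free_module, of G] G_free
        unfolding U_E_def by blast
      then show ?thesis
        using lm_in_msupp[of u] U_outside that by blast
    qed
    then show "{mvec (lm ord w) 1 :: ('n, 'k) pvec | w. w \<in> U \<and> w \<noteq> 0} \<subseteq> {f. msupp f \<subseteq> D}"
      by (auto simp: msupp_mvec D_def)
  qed
  moreover have "mvec (lm ord v) 1 \<in> lm_space ord V"
    unfolding lm_space_def using assms by (intro k_mod.span_base) auto
  moreover have "R_mod.span {mvec (lm ord h') 1 | h'. h' \<in> H_A s t a \<beta>} + lm_space ord U =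
      lm_space ord V"
    using groebner_form by (simp add: groebner_form_def rel_groebner_basis_def)
  ultimately have "mvec (lm ord v) 1 \<in> {f :: ('n, 'k) pvec. msupp f \<subseteq> D}"
    using R_mod.subspace_add[OF sub] by (metis (no_types, lifting) set_plus_elim subsetD)
  then have "lm ord v \<in> D"
    by (simp add: msupp_mvec)
  then show ?thesis
    using outside_divisible_by_G[of "lm ord v"] fst_lm_less[of v] V_free assms
    unfolding D_def by blast
qed

section \<open>The Schreyer order\<close>

abbreviation syz_map :: "('n, 'k) pvec \<Rightarrow> ('n, 'k) pvec" where
  "syz_map \<equiv> H_map s t a \<beta>"

text \<open>
  The leading monomial of the image of \<open>X^\<gamma> e_j\<close> under \<open>e_j \<mapsto> h_j\<close>.
\<close>
definition image_lm :: "'n mmon \<Rightarrow> 'n mmon" where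
  "image_lm m = mmul (snd m) (lm ord (h (fst m)))"

text \<open>
  Ties are broken in favour of the larger component, so that of the two terms that a pair
  \<open>j1 < j2\<close> contributes to its column the one in component \<open>j2\<close> leads.
\<close>
definition schreyer_order :: "'n mmon rel" where
  "schreyer_order = {(m, m'). fst m < t \<and> fst m' < t \<and>
     ((image_lm m, image_lm m') \<in> ord - Id \<or> image_lm m = image_lm m' \<and> fst m \<le> fst m')}"

lemma schreyer_order_iff:
  "(m, m') \<in> schreyer_order \<longleftrightarrow> fst m < t \<and> fst m' < t \<and>
     ((image_lm m, image_lm m') \<in> ord - Id \<or> image_lm m = image_lm m' \<and> fst m \<le> fst m')"
  by (simp add: schreyer_order_def)

lemma syz_map_mvec:
  "fst m < t \<Longrightarrow> syz_map (mvec m c) = vscale (Poly_Mapping.single (snd m) c) (h (fst m))"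
  using mat_map_mvec[of "fst m" "map h [0..<t]" "snd m" c] by simp

lemma fst_image_lm: "fst (image_lm m) = fst (lm ord (h (fst m)))"
  by (simp add: image_lm_def)

lemma image_lm_mmul: "image_lm (mmul \<mu> m) = mmul \<mu> (image_lm m)"
  by (simp add: image_lm_def mmul_mmul)

lemma image_lm_inj: "image_lm m = image_lm m' \<Longrightarrow> fst m = fst m' \<Longrightarrow> m = m'"
  by (simp add: image_lm_def mmul_def prod_eq_iff)

lemma ord_strict_trans:
  "(m, m') \<in> ord - Id \<Longrightarrow> (m', m'') \<in> ord - Id \<Longrightarrow> (m, m'') \<in> ord - Id"
  using ord_trans ord_antisym by blast

lemma ord_strict_mmul: "(m, m') \<in> ord - Id \<Longrightarrow> (mmul \<mu> m, mmul \<mu> m') \<in> ord - Id"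
  using ord_mmul by simp

text \<open>
  On monomials with distinct images the order is pulled back from \<open>ord\<close>; monomials with the same
  image are distinguished by their component, because \<open>mmul\<close> is cancellative. Multiplying by a
  monomial does not change components, so it preserves the comparison.
\<close>
lemma monomial_order_schreyer: "monomial_order t schreyer_order"
proof -
  have "refl_on {m. fst m < t} schreyer_order"
    by (auto simp: refl_on_def schreyer_order_def)
  moreover have "schreyer_order \<subseteq> {m. fst m < t} \<times> {m. fst m < t}"
    by (auto simp: schreyer_order_iff)
  moreover have "trans schreyer_order"
  proof (rule transI)
    fix m m' m'' assume "(m, m') \<in> schreyer_order" "(m', m'') \<in> schreyer_order"
    then show "(m, m'') \<in> schreyer_order"
      unfolding schreyer_order_iff
    proof (elim conjE disjE, goal_cases)
      case 1
      then show ?case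
        using ord_strict_trans[of "image_lm m" "image_lm m'" "image_lm m''"] by blast
    qed simp_all
  qed
  moreover have "antisym schreyer_order"
  proof (rule antisymI)
    fix m m' assume "(m, m') \<in> schreyer_order" "(m', m) \<in> schreyer_order"
    then show "m = m'"
      unfolding schreyer_order_iff
    proof (elim conjE disjE, goal_cases)
      case 1
      then show ?case
        using ord_antisym[of "image_lm m" "image_lm m'"] by blast
    next
      case 4
      then show ?case
        using image_lm_inj[of m m'] by simp
    qed simp_all
  qed
  moreover have "total_on {m. fst m < t} schreyer_order"
  proof (rule total_onI)
    fix m m' :: "'n mmon"
    assume "m \<in> {m. fst m < t}" "m' \<in> {m. fst m < t}"
    moreover from this have "(image_lm m, image_lm m') \<in> ord \<or> (image_lm m', image_lm m) \<in> ord"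
      by (intro ord_total) (simp_all add: fst_image_lm fst_lm_h)
    ultimately show "(m, m') \<in> schreyer_order \<or> (m', m) \<in> schreyer_order"
      unfolding schreyer_order_iff using linear[of "fst m" "fst m'"]
      by (cases "image_lm m = image_lm m'") simp_all
  qed
  moreover have "wf (schreyer_order - Id)"
  proof (rule wf_subset)
    show "wf (inv_image ((ord - Id) <*lex*> less_than) (\<lambda>m. (image_lm m, fst m)))"
      by (intro wf_inv_image wf_lex_prod ord_wf wf_less_than)
    show "schreyer_order - Id \<subseteq> inv_image ((ord - Id) <*lex*> less_than) (\<lambda>m. (image_lm m, fst m))"
    proof (rule subrelI)
      fix m m' assume "(m, m') \<in> schreyer_order - Id"
      then have "(m, m') \<in> schreyer_order" "m \<noteq> m'"
        by simp_all
      then show "(m, m') \<in> inv_image ((ord - Id) <*lex*> less_than) (\<lambda>m. (image_lm m, fst m))"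
        using image_lm_inj[of m m'] unfolding schreyer_order_iff
        by (cases "image_lm m = image_lm m'") (simp_all add: nat_less_le, blast)
    qed
  qed
  moreover have mul: "(mmul \<mu> m, mmul \<mu> m') \<in> schreyer_order"
    if "(m, m') \<in> schreyer_order" for \<mu> m m'
    using that ord_strict_mmul[of "image_lm m" "image_lm m'" \<mu>]
    unfolding schreyer_order_iff image_lm_mmul fst_mmul mmul_inj by blast
  moreover have "((i, \<mu> + \<gamma>), (j, \<mu> + \<delta>)) \<in> schreyer_order"
    if "((i, \<gamma>), (j, \<delta>)) \<in> schreyer_order" for i \<gamma> j \<delta> \<mu>
    using mul[OF that, of \<mu>] by (simp add: mmul_def)
  ultimately show ?thesis
    unfolding monomial_order_def order_on_defs by blast
qed

sublocale Schreyer: module_order t schreyer_order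
  by unfold_locales (rule monomial_order_schreyer)

section \<open>Relative division\<close>

text \<open>
  Dividend, quotients and the divided vector \<open>v\<close> are related modulo \<open>U\<close> without a remainder: since
  \<open>f\<close> stays in \<open>V\<close>, its leading term can always be reduced. The monomial \<open>B\<close>, later the lcm of an
  S-vector, bounds the images of all quotient terms.
\<close>
definition division_invariant ::
  "('n, 'k) pvec \<Rightarrow> 'n mmon \<Rightarrow> ('n, 'k) div_state \<Rightarrow> bool" where
  "division_invariant v B st = (case st of (f, p, q) \<Rightarrow>
     f \<in> V \<and> q \<in> free_module t \<and> syz_map q + f - v \<in> U \<and>
     strictly_bounded_by B f \<and> (\<forall>m\<in>msupp q. (image_lm m, B) \<in> ord - Id))"

lemma strictly_bounded_by_lower:
  assumes "strictly_bounded_by B f" "(B, B') \<in> ord - Id"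
  shows "strictly_bounded_by B' f"
  using assms ord_strict_trans unfolding strictly_bounded_by_def by blast

text \<open>
  By the Groebner hypothesis, the rule that moves a leading term to the remainder never applies to a
  dividend in \<open>V\<close>.
\<close>
lemma div_step_cases:
  assumes step: "div_step ord G t h (f, p, q) (f', p', q')" and f: "f \<in> V"
  shows "f \<noteq> 0"
    and "(\<exists>g\<in>G. mmon_dvd (lm ord g) (lm ord f) \<and>
            f' = f - vscale (lt_quot ord f g) g \<and> q' = q) \<or>
         (\<exists>j<t. mmon_dvd (lm ord (h j)) (lm ord f) \<and>
            f' = f - vscale (lt_quot ord f (h j)) (h j) \<and>
            q' = q + Poly_Mapping.single j (lt_quot ord f (h j)))"
proof -
  show "f \<noteq> 0"
    using step by cases auto
  show "(\<exists>g\<in>G. mmon_dvd (lm ord g) (lm ord f) \<and>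
      f' = f - vscale (lt_quot ord f g) g \<and> q' = q) \<or>
      (\<exists>j<t. mmon_dvd (lm ord (h j)) (lm ord f) \<and>
      f' = f - vscale (lt_quot ord f (h j)) (h j) \<and>
      q' = q + Poly_Mapping.single j (lt_quot ord f (h j)))"
    using step
  proof cases
    case move_lt
    then show ?thesis
      using lm_V_divisible[OF f \<open>f \<noteq> 0\<close>] by metis
  qed metis+
qed

text \<open>
  A quotient term added in a step has the image \<open>lm f\<close>, which is below \<open>B\<close> as long as \<open>f\<close> is; and
  what remains of \<open>f\<close> is below \<open>lm f\<close>.
\<close>
lemma division_invariant_step:
  assumes step: "div_step ord G t h (f, p, q) (f', p', q')"
    and inv: "division_invariant v B (f, p, q)"
  shows "division_invariant v B (f', p', q')" and "strictly_bounded_by (lm ord f) f'"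
proof -
  have f: "f \<in> V" "q \<in> free_module t" "syz_map q + f - v \<in> U" "strictly_bounded_by B f"
    and q: "\<forall>m\<in>msupp q. (image_lm m, B) \<in> ord - Id"
    using inv by (auto simp: division_invariant_def)
  have f_free: "f \<in> free_module s"
    using f V_free by blast
  have f0: "f \<noteq> 0"
    using div_step_cases(1)[OF step f(1)] .
  have lm_B: "(lm ord f, B) \<in> ord - Id"
    by (rule strictly_bounded_by_lm[OF f(4) f_free f0])
  have V_diff: "f - vscale c w \<in> V" if "w \<in> V" for c w
    using that f(1) by (intro R_mod.subspace_diff[OF subspace_V] R_mod.subspace_scale[OF subspace_V])
  from div_step_cases(2)[OF step f(1)]
  have "division_invariant v B (f', p', q') \<and> strictly_bounded_by (lm ord f) f'"
  proof (elim disjE bexE exE conjE)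
    fix g assume g: "g \<in> G" "mmon_dvd (lm ord g) (lm ord f)"
      and f': "f' = f - vscale (lt_quot ord f g) g" and q': "q' = q"
    have "strictly_bounded_by (lm ord f) f'"
      unfolding f' by (rule reduction_step[OF f_free f0 G_free[OF g(1)] G_nonzero[OF g(1)] g(2)])
    moreover have "syz_map q' + f' - v \<in> U"
    proof -
      have "syz_map q' + f' - v = (syz_map q + f - v) - vscale (lt_quot ord f g) g"
        by (simp add: f' q')
      also have "\<dots> \<in> U"
        by (rule R_mod.subspace_diff[OF subspace_U f(3)
              R_mod.subspace_scale[OF subspace_U G_in_U[OF g(1)]]])
      finally show ?thesis .
    qed
    ultimately show ?thesis
      using f(2) q V_diff[OF G_in_V[OF g(1)], of "lt_quot ord f g", folded f']
        strictly_bounded_by_lower[OF _ lm_B, of f']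
      unfolding division_invariant_def q' by blast
  next
    fix j assume j: "j < t" "mmon_dvd (lm ord (h j)) (lm ord f)"
      and f': "f' = f - vscale (lt_quot ord f (h j)) (h j)"
      and q': "q' = q + Poly_Mapping.single j (lt_quot ord f (h j))"
    define m where "m = (j, snd (lm ord f) - snd (lm ord (h j)))"
    define c where "c = lc ord f / lc ord (h j)"
    have m: "image_lm m = lm ord f"
      using j(2) by (simp add: image_lm_def m_def mmon_dvd_iff)
    have q'_eq: "q' = q + mvec m c"
      by (simp add: q' mvec_def m_def c_def lt_quot_def)
    have fst_m: "fst m < t"
      using j(1) by (simp add: m_def)
    have "strictly_bounded_by (lm ord f) f'"
      unfolding f' by (rule reduction_step[OF f_free f0 h_free h_nonzero[OF j(1)] j(2)])
    moreover have "syz_map q' + f' - v = syz_map q + f - v"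
      unfolding q'_eq f' mat_map_add syz_map_mvec[OF fst_m]
      by (simp add: m_def c_def lt_quot_def)
    moreover have "\<forall>m'\<in>msupp q'. (image_lm m', B) \<in> ord - Id"
    proof
      fix m' assume "m' \<in> msupp q'"
      then have "m' \<in> msupp q \<or> m' = m"
        by (auto simp: q'_eq in_msupp vcoeff_add vcoeff_mvec split: if_splits)
      then show "(image_lm m', B) \<in> ord - Id"
        using q lm_B m by metis
    qed
    moreover have "q' \<in> free_module t"
      unfolding q'_eq using f(2) fst_m
      by (intro R_mod.subspace_add[OF subspace_free_module]) (auto simp: free_module_msupp msupp_mvec)
    ultimately show ?thesis
      using f(3) V_diff[OF h_in_V[OF j(1)], of "lt_quot ord f (h j)", folded f']
        strictly_bounded_by_lower[OF _ lm_B, of f']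
      unfolding division_invariant_def by auto
  qed
  then show "division_invariant v B (f', p', q')" "strictly_bounded_by (lm ord f) f'"
    by auto
qed

section \<open>The columns produced by the algorithm\<close>

abbreviation tasks :: "'n task set" where
  "tasks \<equiv> fp_tasks ord s t a \<beta>"

abbreviation task_vec :: "'n task \<Rightarrow> ('n, 'k) pvec" where
  "task_vec \<equiv> task_S_vec ord s a \<alpha> \<beta>"

abbreviation task_column :: "'n task \<Rightarrow> ('n, 'k) pvec \<Rightarrow> ('n, 'k) pvec" where
  "task_column \<equiv> task_sigma ord s a \<alpha> \<beta>"

text \<open>
  The leading monomial, in the Schreyer order, of the column computed for a pair; its image is the
  lcm at which the S-vector cancels.
\<close>
fun task_lead :: "'n task \<Rightarrow> 'n mmon" where
  "task_lead (Pair_hh j1 j2) = (j2, sup (\<beta> j1) (\<beta> j2) - \<beta> j2)"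
| "task_lead (Pair_hg j k) =
     (j, sup (\<beta> j) (\<lambda>l. if l = k then \<alpha> (fst (lm ord (h j))) k + 1 else 0) - \<beta> j)"

text \<open>
  Support outside the boxes is a condition on single coefficients, which is how both the kernel of
  \<open>phi\<close> and the cancellation argument reach these vectors; membership of the image in \<open>U\<close> implies it.
\<close>
definition syzygies :: "('n, 'k) pvec set" where
  "syzygies = {x \<in> free_module t. msupp (syz_map x) \<subseteq> {m. outside m}}"

lemma subspace_syzygies: "R_mod.subspace syzygies"
  unfolding syzygies_def
  using R_mod.subspace_add[OF subspace_outside] R_mod.subspace_scale[OF subspace_outside]
    R_mod.subspace_add[OF subspace_free_module] R_mod.subspace_scale[OF subspace_free_module]
    R_mod.subspace_0[OF subspace_free_module]
  by (intro R_mod.subspaceI) (auto simp: mat_map_add mat_map_vscale)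

lemma task_column_split: "task_column \<tau> q = task_column \<tau> 0 - q"
  by (cases \<tau>) (simp_all add: Let_def)

lemma sup_diff_add: "sup \<gamma> \<delta> - \<gamma> + \<gamma> = (sup \<gamma> \<delta> :: 'n \<Rightarrow> nat)"
  "sup \<gamma> \<delta> - \<delta> + \<delta> = (sup \<gamma> \<delta> :: 'n \<Rightarrow> nat)"
  by (simp_all add: fun_eq_iff sup_max)

text \<open>
  The column before division, \<open>task_column \<tau> 0\<close>, consists of one or two terms whose \<open>image_lm\<close> is
  the lcm. It maps to the S-vector itself, up to a multiple of an element of
  \<open>G\<close> in the case of a pair \<open>(j, k)\<close>, while the S-vector lies strictly below the lcm.
\<close>
lemma task_properties:
  assumes "\<tau> \<in> tasks"
  shows task_vec_in_V: "task_vec \<tau> \<in> V"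
    and task_vec_bounded: "strictly_bounded_by (image_lm (task_lead \<tau>)) (task_vec \<tau>)"
    and task_head_free: "task_column \<tau> 0 \<in> free_module t"
    and task_head_image: "syz_map (task_column \<tau> 0) - task_vec \<tau> \<in> U"
    and task_head_lead: "task_lead \<tau> \<in> msupp (task_column \<tau> 0)"
    and task_head_bounded: "Schreyer.bounded_by (task_lead \<tau>) (task_column \<tau> 0)"
proof -
  have V_comb: "vscale c v - vscale d w \<in> V" if "v \<in> V" "w \<in> V" for c d v w
    using that R_mod.subspace_diff[OF subspace_V] R_mod.subspace_scale[OF subspace_V] by blast
  have "task_vec \<tau> \<in> V \<and> strictly_bounded_by (image_lm (task_lead \<tau>)) (task_vec \<tau>) \<and>
    task_column \<tau> 0 \<in> free_module t \<and> syz_map (task_column \<tau> 0) - task_vec \<tau> \<in> U \<and>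
    task_lead \<tau> \<in> msupp (task_column \<tau> 0) \<and>
    Schreyer.bounded_by (task_lead \<tau>) (task_column \<tau> 0)"
  proof (cases \<tau>)
    case (Pair_hh j1 j2)
    then have j: "j1 < j2" "j1 < t" "j2 < t" and comp: "fst (lm ord (h j1)) = fst (lm ord (h j2))"
      using assms by (auto simp: fp_tasks_def)
    define c1 where "c1 = inverse (lc ord (h j1))"
    define c2 where "c2 = inverse (lc ord (h j2))"
    define m1 where "m1 = (j1, sup (\<beta> j1) (\<beta> j2) - \<beta> j1)"
    define m2 where "m2 = (j2, sup (\<beta> j1) (\<beta> j2) - \<beta> j2)"
    have c: "c1 \<noteq> 0" "c2 \<noteq> 0"
      using j lc_nonzero[OF h_free h_nonzero] by (simp_all add: c1_def c2_def)
    have im: "image_lm m1 = image_lm m2" "image_lm m2 = (fst (lm ord (h j1)), sup (\<beta> j1) (\<beta> j2))"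
      using j comp by (simp_all add: image_lm_def m1_def m2_def mmul_def snd_lm_h sup_diff_add)
    have vec: "task_vec \<tau> = vscale (Poly_Mapping.single (snd m1) c1) (h j1) -
        vscale (Poly_Mapping.single (snd m2) c2) (h j2)"
      using j by (simp add: Pair_hh S_vec_def snd_lm_h Let_def m1_def m2_def c1_def c2_def)
    have col: "task_column \<tau> 0 = mvec m1 c1 - mvec m2 c2"
      by (simp add: Pair_hh m1_def m2_def c1_def c2_def)
    have lead: "task_lead \<tau> = m2"
      by (simp add: Pair_hh m2_def)
    have "task_vec \<tau> \<in> V"
      unfolding vec using j h_in_V by (intro V_comb) auto
    moreover have "strictly_bounded_by (image_lm m2) (task_vec \<tau>)"
      unfolding im(2) using S_vec_strictly_bounded_by[OF h_free h_nonzero h_free h_nonzero, of j1 j2]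
        j comp by (simp add: Pair_hh snd_lm_h)
    moreover have "syz_map (task_column \<tau> 0) = task_vec \<tau>"
      unfolding vec col mat_map_diff using j
      by (subst (1 2) syz_map_mvec) (simp_all add: m1_def m2_def)
    moreover have "m1 \<noteq> m2"
      using j by (simp add: m1_def m2_def)
    moreover have supp: "msupp (mvec m1 c1 - mvec m2 c2) = {m1, m2}"
      using c \<open>m1 \<noteq> m2\<close> by (auto simp: in_msupp vcoeff_diff vcoeff_mvec split: if_splits)
    moreover have "(m1, m2) \<in> schreyer_order" "(m2, m2) \<in> schreyer_order"
      using j im(1) by (auto simp: schreyer_order_iff m1_def m2_def)
    moreover have "fst m1 < t" "fst m2 < t"
      using j by (simp_all add: m1_def m2_def)
    ultimately show ?thesis
      using R_mod.subspace_0[OF subspace_U]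
      by (simp add: lead col free_module_msupp Schreyer.bounded_by_def)
  next
    case (Pair_hg j k)
    then have j: "j < t"
      using assms by (auto simp: fp_tasks_def)
    define i where "i = fst (lm ord (h j))"
    define g where "g = (gen_E \<alpha> i k :: ('n, 'k) pvec)"
    define c where "c = inverse (lc ord (h j))"
    define \<epsilon> where "\<epsilon> = (\<lambda>l. if l = k then \<alpha> i k + 1 else 0)"
    define m where "m = (j, sup (\<beta> j) \<epsilon> - \<beta> j)"
    have i: "i < s"
      using fst_lm_h[OF j] by (simp add: i_def)
    have g: "g \<in> G"
      using gen_E_in_G[OF i] by (simp add: g_def)
    have lm_g: "lm ord g = (i, \<epsilon>)"
      using lm_gen_E[OF i] by (simp add: g_def \<epsilon>_def)
    have c0: "c \<noteq> 0"
      using j lc_nonzero[OF h_free h_nonzero] by (simp add: c_def)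
    define d where "d = Poly_Mapping.single (sup (\<beta> j) \<epsilon> - \<epsilon>) (inverse (lc ord g))"
    have im: "image_lm m = (i, sup (\<beta> j) \<epsilon>)"
      using j by (simp add: image_lm_def m_def mmul_def snd_lm_h sup_diff_add i_def)
    have vec: "task_vec \<tau> = vscale (Poly_Mapping.single (snd m) c) (h j) - vscale d g"
      using j lm_g by (simp add: Pair_hg S_vec_def snd_lm_h Let_def m_def c_def d_def
          flip: i_def g_def)
    have col: "task_column \<tau> 0 = mvec m c"
      unfolding Pair_hg m_def c_def \<epsilon>_def i_def by simp
    have lead: "task_lead \<tau> = m"
      unfolding Pair_hg m_def \<epsilon>_def i_def by simp
    have "task_vec \<tau> \<in> V"
      unfolding vec using j h_in_V G_in_V[OF g] by (intro V_comb) auto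
    moreover have "strictly_bounded_by (image_lm m) (task_vec \<tau>)"
      using S_vec_strictly_bounded_by[OF h_free h_nonzero G_free G_nonzero, of j g] j g lm_g
      by (simp add: Pair_hg snd_lm_h im flip: i_def g_def)
    moreover have "syz_map (mvec m c) - task_vec \<tau> \<in> U"
    proof -
      have "syz_map (mvec m c) - task_vec \<tau> = vscale d g"
        unfolding vec using j by (subst syz_map_mvec) (simp_all add: m_def)
      then show ?thesis
        using G_in_U[OF g] R_mod.subspace_scale[OF subspace_U] by simp
    qed
    moreover have "(m, m) \<in> schreyer_order" "fst m < t"
      using j by (auto simp: schreyer_order_iff m_def)
    ultimately show ?thesis
      using c0 by (simp add: lead col free_module_msupp Schreyer.bounded_by_def msupp_mvec)
  qed
  then show "task_vec \<tau> \<in> V" "strictly_bounded_by (image_lm (task_lead \<tau>)) (task_vec \<tau>)"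
    "task_column \<tau> 0 \<in> free_module t" "syz_map (task_column \<tau> 0) - task_vec \<tau> \<in> U"
    "task_lead \<tau> \<in> msupp (task_column \<tau> 0)"
    "Schreyer.bounded_by (task_lead \<tau>) (task_column \<tau> 0)"
    by auto
qed

lemma division_invariant_init:
  assumes "\<tau> \<in> tasks"
  shows "division_invariant (task_vec \<tau>) (image_lm (task_lead \<tau>)) (task_vec \<tau>, 0, 0)"
  using task_vec_in_V[OF assms] task_vec_bounded[OF assms]
    R_mod.subspace_0[OF subspace_U] R_mod.subspace_0[OF subspace_free_module]
  by (simp add: division_invariant_def)

text \<open>
  Subtracting the quotients turns the image of \<open>task_column \<tau> 0\<close> into an element of \<open>U\<close>, and the
  quotients lie strictly below the lcm, hence cannot touch the leading term.
\<close>
lemma task_column_properties: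
  assumes \<tau>: "\<tau> \<in> tasks"
    and inv: "division_invariant (task_vec \<tau>) (image_lm (task_lead \<tau>)) (0, p, q)"
  shows task_column_syzygy: "task_column \<tau> q \<in> syzygies"
    and task_column_nonzero: "task_column \<tau> q \<noteq> 0"
    and lm_task_column: "lm schreyer_order (task_column \<tau> q) = task_lead \<tau>"
proof -
  have q: "q \<in> free_module t" "syz_map q - task_vec \<tau> \<in> U"
    and q_below: "\<forall>m\<in>msupp q. (image_lm m, image_lm (task_lead \<tau>)) \<in> ord - Id"
    using inv by (auto simp: division_invariant_def)
  have free: "task_column \<tau> q \<in> free_module t"
    unfolding task_column_split[of \<tau> q]
    by (rule R_mod.subspace_diff[OF subspace_free_module task_head_free[OF \<tau>] q(1)])
  have "syz_map (task_column \<tau> q) =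
      (syz_map (task_column \<tau> 0) - task_vec \<tau>) - (syz_map q - task_vec \<tau>)"
    unfolding task_column_split[of \<tau> q] mat_map_diff by simp
  then have "syz_map (task_column \<tau> q) \<in> U"
    using R_mod.subspace_diff[OF subspace_U task_head_image[OF \<tau>] q(2)] by simp
  then show "task_column \<tau> q \<in> syzygies"
    using free U_outside by (auto simp: syzygies_def)
  have lead: "task_lead \<tau> \<in> msupp (task_column \<tau> q)"
    using task_head_lead[OF \<tau>] q_below unfolding task_column_split[of \<tau> q]
    by (auto simp: in_msupp vcoeff_diff)
  then show "task_column \<tau> q \<noteq> 0"
    by auto
  have "fst (task_lead \<tau>) < t"
    using lead free by (auto simp: free_module_msupp)
  then have "Schreyer.bounded_by (task_lead \<tau>) q"
    using q(1) q_below unfolding Schreyer.bounded_by_def free_module_msupp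
    unfolding schreyer_order_iff by simp
  then have "Schreyer.bounded_by (task_lead \<tau>) (task_column \<tau> q)"
    using task_head_bounded[OF \<tau>] unfolding task_column_split[of \<tau> q]
    by (auto simp: Schreyer.bounded_by_def in_msupp vcoeff_diff)
  with lead show "lm schreyer_order (task_column \<tau> q) = task_lead \<tau>"
    by (rule Schreyer.lm_eqI)
qed

text \<open>
  The core of Schreyer's argument: the leading monomial of the image of the leading term of a syzygy
  either lies in \<open>U\<close> or also occurs in the image of a second term. These are the situations from which the algorithm forms its pairs.
\<close>
lemma lm_syzygy_divisible:
  assumes x: "x \<in> syzygies" "x \<noteq> 0"
  shows "\<exists>\<tau>\<in>tasks. mmon_dvd (task_lead \<tau>) (lm schreyer_order x)"
proof -
  define m where "m = lm schreyer_order x"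
  obtain j \<gamma> where m_eq: "m = (j, \<gamma>)"
    by (cases m)
  define i where "i = fst (lm ord (h j))"
  define \<mu> where "\<mu> = \<gamma> + \<beta> j"
  have x_free: "x \<in> free_module t"
    using x by (simp add: syzygies_def)
  have m_in: "(j, \<gamma>) \<in> msupp x"
    using Schreyer.lm_in_msupp[OF x_free x(2)] by (simp add: m_eq flip: m_def)
  then have j: "j < t"
    using x_free by (auto simp: free_module_msupp)
  have i: "i < s"
    using fst_lm_h[OF j] by (simp add: i_def)
  have im: "image_lm m = (i, \<mu>)"
    using j by (simp add: image_lm_def m_eq mmul_def snd_lm_h i_def \<mu>_def)
  have "\<beta> j \<le> \<mu>" "\<mu> - \<beta> j = \<gamma>"
    by (auto simp: \<mu>_def le_fun_def fun_eq_iff)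
  show ?thesis
  proof (cases "\<mu> \<le> \<alpha> i")
    case False
    \<comment> \<open>The exponent of some variable exceeds the box, so a generator of \<open>U\<close> divides \<open>X^\<mu> e_i\<close>.\<close>
    then obtain k where k: "\<alpha> i k < \<mu> k"
      by (auto simp: le_fun_def not_le)
    have "mmon_dvd (task_lead (Pair_hg j k)) m"
      using k by (auto simp: mmon_dvd_def m_eq le_fun_def \<mu>_def sup_max simp flip: i_def)
    moreover have "Pair_hg j k \<in> tasks"
      using j by (simp add: fp_tasks_def)
    ultimately show ?thesis
      unfolding m_def by blast
  next
    case True
    \<comment> \<open>The coefficient of \<open>syz_map x\<close> at \<open>X^\<mu> e_i\<close> must vanish, which takes at least two summands.\<close>
    define summand where "summand l = (if \<beta> l \<le> \<mu> then vcoeff x (l, \<mu> - \<beta> l) * a i l else 0)" for l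
    have "vcoeff (syz_map x) (i, \<mu>) = 0"
      using x(1) True by (auto simp: syzygies_def msupp_def)
    then have "(\<Sum>l<t. summand l) = 0"
      using i by (simp add: vcoeff_H_map summand_def cong: if_cong)
    moreover have "summand j \<noteq> 0"
    proof -
      have "a i j \<noteq> 0"
        using lm_in_msupp[OF h_free h_nonzero[OF j]] by (simp add: in_msupp vcoeff_hvec i_def split: if_splits)
      then show ?thesis
        using m_in \<open>\<beta> j \<le> \<mu>\<close> \<open>\<mu> - \<beta> j = \<gamma>\<close> by (simp add: summand_def in_msupp)
    qed
    ultimately obtain l where l: "l < t" "l \<noteq> j" "summand l \<noteq> 0"
      using j by (metis (no_types, lifting) finite_lessThan lessThan_iff sum.remove sum.neutral
          Diff_iff insertCI add.right_neutral)
    then have l': "\<beta> l \<le> \<mu>" "(l, \<mu> - \<beta> l) \<in> msupp x" "a i l \<noteq> 0"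
      by (auto simp: summand_def in_msupp split: if_splits)
    have add: "\<mu> - \<beta> l + \<beta> l = \<mu>"
      using l'(1) by (auto simp: le_fun_def fun_eq_iff)
    have im_l: "image_lm (l, \<mu> - \<beta> l) = (fst (lm ord (h l)), \<mu>)"
      using l(1) add by (simp add: image_lm_def mmul_def snd_lm_h)
    have "((l, \<mu> - \<beta> l), m) \<in> schreyer_order"
      using Schreyer.bounded_by_lm[OF x_free x(2)] l'(2) by (simp add: Schreyer.bounded_by_def m_def)
    then have order: "((fst (lm ord (h l)), \<mu>), (i, \<mu>)) \<in> ord - Id \<or> fst (lm ord (h l)) = i \<and> l \<le> j"
      by (simp add: schreyer_order_iff im_l m_eq im[unfolded m_eq])
    \<comment> \<open>The term in component \<open>l\<close> contributes at \<open>X^\<mu> e_i\<close>, so its image is at least that monomial;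
      as \<open>m\<close> leads \<open>x\<close>, it is also at most that. Hence \<open>l\<close> ties with \<open>j\<close> and is smaller.\<close>
    have "(i, \<beta> l) \<in> msupp (h l)"
      using l'(3) i by (simp add: in_msupp vcoeff_hvec)
    then have "((i, \<beta> l), lm ord (h l)) \<in> ord"
      using bounded_by_lm[OF h_free h_nonzero[OF l(1)]] by (simp add: bounded_by_def)
    from ord_mmul[OF this, of "\<mu> - \<beta> l"]
    have "((i, \<mu>), (fst (lm ord (h l)), \<mu>)) \<in> ord"
      using l(1) by (simp add: mmul_def snd_lm_h add)
    with order have comp: "fst (lm ord (h l)) = i" "l < j"
      using l(2) ord_antisym by auto
    then have "Pair_hh l j \<in> tasks"
      using j by (simp add: fp_tasks_def i_def)
    moreover have "mmon_dvd (task_lead (Pair_hh l j)) m"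
      using l'(1) by (auto simp: mmon_dvd_def m_eq le_fun_def \<mu>_def sup_max le_diff_conv)
    ultimately show ?thesis
      unfolding m_def by blast
  qed
qed

section \<open>The algorithm\<close>

definition algorithm_invariant :: "('n, 'k) fp_config \<Rightarrow> bool" where
  "algorithm_invariant cfg = (case cfg of (T, d, P) \<Rightarrow>
     T \<subseteq> tasks \<and> set P \<subseteq> syzygies \<and>
     (\<forall>\<tau> st. d = Some (\<tau>, st) \<longrightarrow>
        \<tau> \<in> tasks \<and> division_invariant (task_vec \<tau>) (image_lm (task_lead \<tau>)) st) \<and>
     (\<forall>\<tau>\<in>tasks. \<tau> \<in> T \<or> (\<exists>st. d = Some (\<tau>, st)) \<or>
        (\<exists>\<sigma>\<in>set P. \<sigma> \<noteq> 0 \<and> lm schreyer_order \<sigma> = task_lead \<tau>)))"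

text \<open>
  The middle entry counts the phases left for the current pair: dividing, about to finish, none.
  Without a division in progress there is no dividend to compare, and such a configuration is
  compared with its neighbours by the first two entries alone.
\<close>
definition config_measure :: "('n, 'k) fp_config \<Rightarrow> nat \<times> nat \<times> 'n mmon" where
  "config_measure cfg = (case cfg of (T, d, P) \<Rightarrow>
     (card T, case d of None \<Rightarrow> (0, undefined)
       | Some (\<tau>, (f, p, q)) \<Rightarrow> (if f = 0 then 1 else 2, lm ord f)))"

definition config_order :: "(nat \<times> nat \<times> 'n mmon) rel" where
  "config_order = less_than <*lex*> (less_than <*lex*> (ord - Id))"

lemma wf_config_order: "wf config_order"
  unfolding config_order_def by (intro wf_lex_prod wf_less_than ord_wf)

lemma finite_tasks: "finite tasks"
proof (rule finite_subset)
  show "tasks \<subseteq> case_prod Pair_hh ` ({..<t} \<times> {..<t}) \<union> case_prod Pair_hg ` ({..<t} \<times> UNIV)"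
    by (auto simp: fp_tasks_def)
qed simp

lemma algorithm_invariant_init: "algorithm_invariant (fp_init ord s t a \<beta>)"
  by (simp add: algorithm_invariant_def fp_init_def)

text \<open>
  A finished division leaves a column with the leading monomial that belongs to its pair, so every
  pair stays represented: as waiting, in progress, or by a column.
\<close>
lemma algorithm_step:
  assumes "fp_step ord s t a \<alpha> \<beta> cfg cfg'" and inv: "algorithm_invariant cfg"
  shows "algorithm_invariant cfg'" and "(config_measure cfg', config_measure cfg) \<in> config_order"
proof -
  have "algorithm_invariant cfg' \<and> (config_measure cfg', config_measure cfg) \<in> config_order"
    using assms(1)
  proof cases
    case (start \<tau> T P)
    then have "\<tau> \<in> tasks" "finite T"
      using inv finite_subset[OF _ finite_tasks] by (auto simp: algorithm_invariant_def)
    moreover from this have "card (T - {\<tau>}) < card T"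
      using start(3) by (intro card_Diff1_less)
    ultimately show ?thesis
      using inv division_invariant_init[of \<tau>] unfolding start
      by (auto simp: algorithm_invariant_def config_measure_def config_order_def)
  next
    case (divide d d' T \<tau> P)
    obtain f p q f' p' q' where d: "d = (f, p, q)" "d' = (f', p', q')"
      by (cases d; cases d')
    have step: "div_step ord G t h (f, p, q) (f', p', q')"
      using divide(3) by (simp add: d)
    have dinv: "division_invariant (task_vec \<tau>) (image_lm (task_lead \<tau>)) (f, p, q)"
      using inv by (auto simp: divide d algorithm_invariant_def)
    note next_inv = division_invariant_step[OF step dinv]
    have "f \<in> V" "f' \<in> V"
      using dinv next_inv(1) by (auto simp: division_invariant_def)
    then have "f \<noteq> 0" "f' \<noteq> 0 \<Longrightarrow> (lm ord f', lm ord f) \<in> ord - Id"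
      using div_step_cases(1)[OF step] strictly_bounded_by_lm[OF next_inv(2)] V_free by auto
    then show ?thesis
      using inv next_inv(1)
      by (auto simp: divide d algorithm_invariant_def config_measure_def config_order_def)
  next
    case (finish \<sigma> \<tau> q T p P)
    have \<tau>: "\<tau> \<in> tasks"
      and dinv: "division_invariant (task_vec \<tau>) (image_lm (task_lead \<tau>)) (0, p, q)"
      using inv by (auto simp: finish algorithm_invariant_def)
    note col = task_column_properties[OF \<tau> dinv, folded finish(3)]
    have "algorithm_invariant cfg'"
      using inv col unfolding finish(1,2) algorithm_invariant_def by auto
    then show ?thesis
      by (simp add: finish(1,2) config_measure_def config_order_def)
  qed
  then show "algorithm_invariant cfg'" "(config_measure cfg', config_measure cfg) \<in> config_order"
    by auto
qed

lemma fp_step_exists: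
  assumes "\<not> (\<exists>cfg'. fp_step ord s t a \<alpha> \<beta> cfg cfg')"
  shows "\<exists>P. cfg = ({}, None, P)"
proof -
  obtain T d P where cfg: "cfg = (T, d, P)"
    by (cases cfg)
  have "d = None"
  proof (rule ccontr)
    assume "d \<noteq> None"
    then obtain \<tau> f p q where d: "d = Some (\<tau>, f, p, q)"
      by (metis option.exhaust prod_cases4)
    show False
    proof (cases "f = 0")
      case True
      then show False
        using assms fp_step.finish[OF refl] unfolding cfg d by blast
    next
      case False
      then have "\<exists>st. div_step ord G t h (f, p, q) st"
        by (metis div_step.intros)
      then show False
        using assms fp_step.divide unfolding cfg d by blast
    qed
  qed
  moreover have "T = {}"
    using assms fp_step.start unfolding cfg \<open>d = None\<close> by blast
  ultimately show ?thesis
    by (simp add: cfg)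
qed

lemma terminates: "fp_terminates ord s t a \<alpha> \<beta>"
  unfolding fp_terminates_def
proof (intro conjI allI impI notI)
  assume "\<exists>c :: nat \<Rightarrow> ('n, 'k) fp_config.
    c 0 = fp_init ord s t a \<beta> \<and> (\<forall>i. fp_step ord s t a \<alpha> \<beta> (c i) (c (Suc i)))"
  then obtain c :: "nat \<Rightarrow> ('n, 'k) fp_config"
    where c: "c 0 = fp_init ord s t a \<beta>" "\<And>i. fp_step ord s t a \<alpha> \<beta> (c i) (c (Suc i))"
    by blast
  have "algorithm_invariant (c i)" for i
  proof (induction i)
    case 0
    show ?case
      using algorithm_invariant_init c(1) by simp
  next
    case (Suc i)
    then show ?case
      by (rule algorithm_step(1)[OF c(2)])
  qed
  then have "(config_measure (c (Suc i)), config_measure (c i)) \<in> config_order" for i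
    by (rule algorithm_step(2)[OF c(2)])
  then show False
    using wf_config_order unfolding wf_iff_no_infinite_down_chain
    by (auto dest!: spec[of _ "\<lambda>i. config_measure (c i)"])
next
  fix cfg
  assume "(fp_step ord s t a \<alpha> \<beta>)\<^sup>*\<^sup>* (fp_init ord s t a \<beta>) cfg \<and>
    \<not> (\<exists>cfg'. fp_step ord s t a \<alpha> \<beta> cfg cfg')"
  then show "\<exists>P. cfg = ({}, None, P)"
    using fp_step_exists by blast
qed

lemma output_presents:
  assumes "fp_output ord s t a \<alpha> \<beta> P"
  shows "free_presentation t P (phi s t a \<alpha> \<beta>) (im_matrix s t a \<alpha> \<beta>)"
proof -
  have "algorithm_invariant cfg"
    if "(fp_step ord s t a \<alpha> \<beta>)\<^sup>*\<^sup>* (fp_init ord s t a \<beta>) cfg" for cfg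
    using that by induction (auto intro: algorithm_invariant_init algorithm_step(1))
  then have "algorithm_invariant ({}, None, P)"
    using assms by (simp add: fp_output_def)
  then have P: "set P \<subseteq> syzygies"
    and lead: "\<And>\<tau>. \<tau> \<in> tasks \<Longrightarrow> \<exists>\<sigma>\<in>set P. \<sigma> \<noteq> 0 \<and> lm schreyer_order \<sigma> = task_lead \<tau>"
    by (auto simp: algorithm_invariant_def)
  have free: "syzygies \<subseteq> free_module t"
    by (auto simp: syzygies_def)
  have "syzygies \<subseteq> R_mod.span (set P)"
  proof (rule Schreyer.submodule_spanned_if_leading_monomials_divide[OF subspace_syzygies free P])
    fix x assume "x \<in> syzygies" "x \<noteq> 0"
    then obtain \<tau> where \<tau>: "\<tau> \<in> tasks" "mmon_dvd (task_lead \<tau>) (lm schreyer_order x)"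
      using lm_syzygy_divisible by blast
    obtain \<sigma> where "\<sigma> \<in> set P" "\<sigma> \<noteq> 0" "lm schreyer_order \<sigma> = task_lead \<tau>"
      using lead[OF \<tau>(1)] by blast
    with \<tau>(2) show "\<exists>d\<in>set P - {0}. mmon_dvd (lm schreyer_order d) (lm schreyer_order x)"
      by (intro bexI[of _ \<sigma>]) simp_all
  qed
  then have "R_mod.span (set P) = syzygies"
    using R_mod.span_minimal[OF P subspace_syzygies] by blast
  moreover have "syzygies = {x \<in> free_module t. phi s t a \<alpha> \<beta> x = 0}"
    unfolding syzygies_def phi_eq_zero_iff by blast
  ultimately show ?thesis
    using P free by (auto simp: free_presentation_def image_mat_map im_matrix_def)
qed

end

theorem theoremD:
  fixes s t :: nat
    and a :: "nat \<Rightarrow> nat \<Rightarrow> 'k::field"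
    and \<alpha> \<beta> :: "nat \<Rightarrow> 'n::finite \<Rightarrow> nat"
    and ord :: "'n mmon rel"
  assumes "monomial_order s ord"
    and "free_injective s t a \<alpha> \<beta>"
    and "groebner_form ord s t a \<alpha> \<beta>"
  shows "fp_terminates ord s t a \<alpha> \<beta> \<and>
    (\<forall>P. fp_output ord s t a \<alpha> \<beta> P \<longrightarrow>
       free_presentation t P (phi s t a \<alpha> \<beta>) (im_matrix s t a \<alpha> \<beta>))"
proof -
  interpret groebner_matrix s ord t a \<alpha> \<beta>
    using assms(1,3) by unfold_locales
  show ?thesis
    using terminates output_presents by blast
qed

end
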